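(* Let $V$ be the vertex set of a bipartite graph (finite, or countably infinite with bounded degree). For $j=0,1,\dots,k$ let $W_j\subseteq V$, $v_j\in W_j$ and $t_j\in[0,1]$, where each $v_j$ is at finite graph distance $\mathrm{dist}(v_j,v_0)$ from $v_0$ in $V$, and define the event $E_j$ by $$E_j:=\{X_{t_j}^{W_j}(v_j)=0\}\ \text{ if } \mathrm{dist}(v_j,v_0)\text{ is even},\qquad E_j:=\{X_{t_j}^{W_j}(v_j)=1\}\ \text{ if }\mathrm{dist}(v_j,v_0)\text{ is odd}.$$ Then for either blocking RSA or the annihilation process, $$P\Big[\bigcap_{j=0}^kE_j\Big]\ge P[E_0]\,P\Big[\bigcap_{j=1}^kE_j\Big].$$ Here the processes $(X_t^{W_j},t\ge0)$ are defined for all $j$ in terms of the same random arrival times $(\tau_v,v\in V)$ (blocking RSA), respectively the same random times $\tau_e$ and random attack directions along each edge $e$ (annihilation process).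
   Context: Graphs have no loops or multiple edges; a subset of $V$ carries the induced subgraph structure. A graph is bipartite if its vertex set can be partitioned into two independent sets. $\mathrm{dist}$ is graph distance in $V$. Processes on a finite graph $U$ with edge set $E_U$; states are $1$ (occupied) and $0$ (vacant), and $X_t^U(v)$ is the state of $v$ at time $t$. Blocking RSA: $\tau_v$, $v\in U$, are i.i.d. uniform on $(0,1)$. All sites are initially vacant; at time $\tau_v$ site $v$ becomes occupied if and only if none of its neighbours is already occupied; otherwise nothing changes. Occupied sites stay occupied forever. Annihilation process: $\tau_e$, $e\in E_U$, are i.i.d. uniform on $(0,1)$, and each edge independently has a random attack direction, each of the two directions having probability $1/2$ (independent of the $\tau_e$). All sites are initially occupied; at time $\tau_e$, $e=\{u,v\}$, if $u$ and $v$ are both occupied immediately before, then the attacked endpoint becomes vacant; otherwise nothing changes. Vacant sites stay vacant forever. For countably infinite graphs $U$ of bounded degree, $X_t^U(v):=\lim_n X_t^{U_n}(v)$, where $(U_n)$ is any sequence of finite subsets of $U$ with $\bigcup_n\bigcap_{m\ge n}U_m=U$ and the process on the induced subgraph $U_n$ uses the same $\tau$'s and attack directions; almost surely this limit exists for all $v,t$ and does not depend on the sequence. *)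

theory Defs
  imports "HOL-Probability.Probability"
begin

section \<open>Graphs\<close>

text \<open>An edge is the set of its two endpoints, so there are no loops and no multiple edges.\<close>

definition simple_graph :: "'a set \<Rightarrow> 'a set set \<Rightarrow> bool" where
  "simple_graph V E \<longleftrightarrow> (\<forall>e\<in>E. e \<subseteq> V \<and> card e = 2)"

definition induced_edges :: "'a set set \<Rightarrow> 'a set \<Rightarrow> 'a set set" where
  "induced_edges E U = {e \<in> E. e \<subseteq> U}"

definition independent_set :: "'a set set \<Rightarrow> 'a set \<Rightarrow> bool" where
  "independent_set E A \<longleftrightarrow> induced_edges E A = {}"

definition bipartite :: "'a set \<Rightarrow> 'a set set \<Rightarrow> bool" where
  "bipartite V E \<longleftrightarrow>
     (\<exists>A B. A \<union> B = V \<and> A \<inter> B = {} \<and> independent_set E A \<and> independent_set E B)"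

definition bounded_degree :: "'a set \<Rightarrow> 'a set set \<Rightarrow> bool" where
  "bounded_degree V E \<longleftrightarrow>
     (\<exists>d::nat. \<forall>v\<in>V. finite {e \<in> E. v \<in> e} \<and> card {e \<in> E. v \<in> e} \<le> d)"

definition adjacency :: "'a set set \<Rightarrow> ('a \<times> 'a) set" where
  "adjacency E = {(u, v). {u, v} \<in> E}"

definition finite_dist :: "'a set set \<Rightarrow> 'a \<Rightarrow> 'a \<Rightarrow> bool" where
  "finite_dist E u v \<longleftrightarrow> (u, v) \<in> (adjacency E)\<^sup>*"

text \<open>Length of a shortest walk; only meaningful if \<open>finite_dist E u v\<close>.\<close>

definition graph_dist :: "'a set set \<Rightarrow> 'a \<Rightarrow> 'a \<Rightarrow> nat" where
  "graph_dist E u v = (LEAST n. (u, v) \<in> adjacency E ^^ n)"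


section \<open>The processes on a finite graph\<close>

text \<open>
  A configuration maps sites to \<open>1\<close> (occupied) or \<open>0\<close> (vacant). The state at time \<open>t\<close> is obtained
  from the initial configuration by running through the arrival times \<open>s \<le> t\<close> in increasing
  order. The update at time \<open>s\<close> reads the configuration immediately before \<open>s\<close>; simultaneous
  arrivals (a null event) are processed in parallel.
\<close>

definition rsa_update ::
    "'a set set \<Rightarrow> 'a set \<Rightarrow> ('a \<Rightarrow> real) \<Rightarrow> real \<Rightarrow> ('a \<Rightarrow> nat) \<Rightarrow> 'a \<Rightarrow> nat" where
  "rsa_update E U \<tau> s \<eta> =
     (\<lambda>v. if v \<in> U \<and> \<tau> v = s \<and> (\<forall>u\<in>U. {u, v} \<in> E \<longrightarrow> \<eta> u = 0) then 1 else \<eta> v)"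

definition finite_rsa ::
    "'a set set \<Rightarrow> ('a \<Rightarrow> real) \<Rightarrow> 'a set \<Rightarrow> real \<Rightarrow> 'a \<Rightarrow> nat" where
  "finite_rsa E \<tau> U t =
     fold (rsa_update E U \<tau>) (sorted_list_of_set {s \<in> \<tau> ` U. s \<le> t}) (\<lambda>v. 0)"

text \<open>The attack direction along \<open>e\<close> is encoded by the attacked endpoint \<open>\<alpha> e \<in> e\<close>.\<close>

definition annihilation_update ::
    "'a set set \<Rightarrow> 'a set \<Rightarrow> ('a set \<Rightarrow> real) \<Rightarrow> ('a set \<Rightarrow> 'a) \<Rightarrow> real \<Rightarrow> ('a \<Rightarrow> nat) \<Rightarrow> 'a \<Rightarrow> nat" where
  "annihilation_update E U \<tau> \<alpha> s \<eta> =
     (\<lambda>v. if \<exists>e\<in>induced_edges E U. \<tau> e = s \<and> (\<forall>u\<in>e. \<eta> u = 1) \<and> \<alpha> e = v then 0 else \<eta> v)"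

definition finite_annihilation ::
    "'a set set \<Rightarrow> ('a set \<Rightarrow> real) \<Rightarrow> ('a set \<Rightarrow> 'a) \<Rightarrow> 'a set \<Rightarrow> real \<Rightarrow> 'a \<Rightarrow> nat" where
  "finite_annihilation E \<tau> \<alpha> U t =
     fold (annihilation_update E U \<tau> \<alpha>)
       (sorted_list_of_set {s \<in> \<tau> ` induced_edges E U. s \<le> t}) (\<lambda>v. 1)"


section \<open>Extension to infinite graphs\<close>

definition finite_approximation :: "(nat \<Rightarrow> 'a set) \<Rightarrow> 'a set \<Rightarrow> bool" where
  "finite_approximation S U \<longleftrightarrow>
     (\<forall>n. finite (S n) \<and> S n \<subseteq> U) \<and> (\<Union>n. \<Inter>m\<in>{n..}. S m) = U"

text \<open>
  For infinite \<open>U\<close> this is the common limit along all finite approximations of \<open>U\<close>. On the null event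
  where there is no such limit, the value is an unspecified constant.
\<close>

definition extend_process ::
    "('a set \<Rightarrow> real \<Rightarrow> 'a \<Rightarrow> nat) \<Rightarrow> 'a set \<Rightarrow> real \<Rightarrow> 'a \<Rightarrow> nat" where
  "extend_process X U t v =
     (if finite U then X U t v
      else THE x. \<forall>S. finite_approximation S U \<longrightarrow> (\<lambda>n. X (S n) t v) \<longlonglongrightarrow> x)"

definition blocking_rsa ::
    "'a set set \<Rightarrow> ('a \<Rightarrow> real) \<Rightarrow> 'a set \<Rightarrow> real \<Rightarrow> 'a \<Rightarrow> nat" where
  "blocking_rsa E \<tau> = extend_process (finite_rsa E \<tau>)"

definition annihilation ::
    "'a set set \<Rightarrow> ('a set \<Rightarrow> real) \<Rightarrow> ('a set \<Rightarrow> 'a) \<Rightarrow> 'a set \<Rightarrow> real \<Rightarrow> 'a \<Rightarrow> nat" where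
  "annihilation E \<tau> \<alpha> = extend_process (finite_annihilation E \<tau> \<alpha>)"


section \<open>The random inputs\<close>

definition rsa_randomness :: "'m measure \<Rightarrow> 'a set \<Rightarrow> ('a \<Rightarrow> 'm \<Rightarrow> real) \<Rightarrow> bool" where
  "rsa_randomness M V \<tau> \<longleftrightarrow>
     prob_space M \<and>
     prob_space.indep_vars M (\<lambda>v. borel) \<tau> V \<and>
     (\<forall>v\<in>V. distr M borel (\<tau> v) = uniform_measure lborel {0<..<1})"

text \<open>
  Mutual independence of all \<open>\<tau> e\<close> and \<open>\<alpha> e\<close> is expressed as independence of the pairs
  \<open>(\<tau> e, \<alpha> e)\<close> over the edges, together with a product law for each pair.
\<close>

definition annihilation_randomness ::
    "'m measure \<Rightarrow> 'a set set \<Rightarrow> ('a set \<Rightarrow> 'm \<Rightarrow> real) \<Rightarrow> ('a set \<Rightarrow> 'm \<Rightarrow> 'a) \<Rightarrow> bool" where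
  "annihilation_randomness M E \<tau> \<alpha> \<longleftrightarrow>
     prob_space M \<and>
     prob_space.indep_vars M (\<lambda>e. borel \<Otimes>\<^sub>M count_space e) (\<lambda>e \<omega>. (\<tau> e \<omega>, \<alpha> e \<omega>)) E \<and>
     (\<forall>e\<in>E. distr M (borel \<Otimes>\<^sub>M count_space e) (\<lambda>\<omega>. (\<tau> e \<omega>, \<alpha> e \<omega>)) =
              uniform_measure lborel {0<..<1} \<Otimes>\<^sub>M uniform_count_measure e)"

definition parity_state :: "'a set set \<Rightarrow> 'a \<Rightarrow> 'a \<Rightarrow> nat" where
  "parity_state E v\<^sub>0 v = (if even (graph_dist E v v\<^sub>0) then 0 else 1)"

end

theory Submission
  imports Defs
begin

text \<open>
  Both processes follow one rule. Items \<open>i\<close> carry arrival times, there is a relation ``\<open>j\<close> blocks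
  \<open>i\<close>'', and an item succeeds if and only if no item that blocks it has succeeded strictly earlier
  (\<open>blocking_solution\<close>). For random sequential adsorption the items are the sites, and neighbours
  block each other. For annihilation the items are the directed edges \<open>(e, x)\<close>, read as an attack on
  \<open>x\<close> along \<open>e\<close>; the direction that is not drawn gets arrival time \<open>\<infinity>\<close>. An attack on \<open>x\<close> succeeds
  if the attacker, the other endpoint of \<open>e\<close>, is still occupied: whether or not \<open>x\<close> was occupied,
  it is vacant afterwards. So \<open>(e, x)\<close> is blocked exactly by the
  attacks on the other endpoint of \<open>e\<close>.

  In a bipartite graph the items fall into two classes such that items only block items of the other
  class. Call one class favoured. If the times of favoured items move forward and those of the other
  items move backward, then every favoured item that succeeded still succeeds, and no other item newly
  succeeds: a new blocker of a favoured item would be an unfavoured item that succeeds now, hence one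
  that succeeded before, at an earlier time still, and vice versa (\<open>blocking_solution_mono\<close>). With
  the favoured class chosen according to the parity of the distance to \<open>v 0\<close>, each of the events of the
  theorem is increasing for this order, whatever \<open>W j\<close> and \<open>t j\<close> are.

  The order is a product of total orders, one for each independent input. For adsorption it is the
  usual or the reversed order of the times. For an edge of the annihilation process the marks are, from
  the top down, early and then late attacks on the favoured endpoint, late and then early attacks on
  the other endpoint. For independent totally ordered inputs the Harris inequality says that increasing
  events are positively correlated (\<open>harris_PiM\<close>). This proves the theorem for finite graphs.

  For infinite sets the inequality passes to the limit, provided that almost surely the finite
  processes converge. That holds since in a graph of bounded degree there is almost surely no infinite
  path of neighbours with decreasing times (\<open>AE_no_infinite_descent\<close>), so that the outcome at every
  item is settled by well-founded induction. Convergence along all finite approximations amounts to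
  convergence along the directed set of finite subsets, which is a countable condition; this gives
  measurability of the limiting events (\<open>measurable_extend_process\<close>).
\<close>

section \<open>The Harris inequality for independent totally ordered inputs\<close>

text \<open>Chebyshev's association inequality: integrate \<open>(f x - f y) * (g x - g y) \<ge> 0\<close> over independent
  copies \<open>x\<close> and \<open>y\<close>.\<close>

lemma (in prob_space) comonotone_integral_mult:
  fixes f g :: "'a \<Rightarrow> real"
  assumes fg: "integrable M f" "integrable M g" "integrable M (\<lambda>x. f x * g x)"
    and comonotone: "\<And>x y. x \<in> space M \<Longrightarrow> y \<in> space M \<Longrightarrow> 0 \<le> (f x - f y) * (g x - g y)"
  shows "expectation f * expectation g \<le> expectation (\<lambda>x. f x * g x)"
proof -
  let ?F = "expectation f" and ?G = "expectation g" and ?H = "expectation (\<lambda>x. f x * g x)"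
  have inner: "f x * g x - f x * ?G - ?F * g x + ?H \<ge> 0" if "x \<in> space M" for x
  proof -
    have "0 \<le> (\<integral>y. (f x - f y) * (g x - g y) \<partial>M)"
      using comonotone that by (intro integral_nonneg_AE) auto
    also have "\<dots> = (\<integral>y. f x * g x - f x * g y - f y * g x + f y * g y \<partial>M)"
      by (intro Bochner_Integration.integral_cong) (auto simp: algebra_simps)
    also have "\<dots> = f x * g x - f x * ?G - ?F * g x + ?H"
      using fg by (simp add: prob_space)
    finally show ?thesis .
  qed
  have "0 \<le> (\<integral>x. f x * g x - f x * ?G - ?F * g x + ?H \<partial>M)"
    using inner by (intro integral_nonneg_AE) auto
  also have "\<dots> = 2 * (?H - ?F * ?G)"
    using fg by (simp add: prob_space algebra_simps)
  finally show ?thesis by simp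
qed

definition increasing_on :: "('i \<Rightarrow> 'b measure) \<Rightarrow> ('i \<Rightarrow> 'b \<Rightarrow> 'b \<Rightarrow> bool) \<Rightarrow> 'i set
    \<Rightarrow> (('i \<Rightarrow> 'b) \<Rightarrow> real) \<Rightarrow> bool" where
  "increasing_on N le I f \<longleftrightarrow> (\<forall>p\<in>space (PiM I N). \<forall>q\<in>space (PiM I N).
     (\<forall>i\<in>I. le i (p i) (q i)) \<longrightarrow> f p \<le> f q)"

text \<open>Induction on the number of coordinates. Fixing all coordinates but one, Chebyshev's inequality
  applies because a total relation makes two increasing functions of one coordinate comonotone. The
  averages over that coordinate are again increasing, so the induction hypothesis applies to them.\<close>

lemma harris_PiM:
  fixes N :: "'i \<Rightarrow> 'b measure" and f g :: "('i \<Rightarrow> 'b) \<Rightarrow> real"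
  assumes "finite I" and prob: "\<And>i. prob_space (N i)"
    and total: "\<And>i x y. i \<in> I \<Longrightarrow> x \<in> space (N i) \<Longrightarrow> y \<in> space (N i) \<Longrightarrow> le i x y \<or> le i y x"
    and "f \<in> borel_measurable (PiM I N)" "g \<in> borel_measurable (PiM I N)"
    and "\<And>p. f p \<in> {0..1}" "\<And>p. g p \<in> {0..1}"
    and "increasing_on N le I f" "increasing_on N le I g"
  shows "(\<integral>p. f p \<partial>PiM I N) * (\<integral>p. g p \<partial>PiM I N) \<le> (\<integral>p. f p * g p \<partial>PiM I N)"
  using assms(1) total assms(4-)
proof (induction I arbitrary: f g rule: finite_induct)
  case empty
  show ?case
    by (simp add: PiM_empty lebesgue_integral_count_space_finite)
next
  case (insert i I)
  interpret Ni: prob_space "N i" by (rule prob)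
  interpret PI: prob_space "PiM I N" by (rule prob_space_PiM) (rule prob)
  interpret PJ: prob_space "PiM (insert i I) N" by (rule prob_space_PiM) (rule prob)
  interpret product_prob_space N "insert i I" by (intro product_prob_spaceI prob)
  have upd: "(\<lambda>(p, y). p(i := y)) \<in> measurable (PiM I N \<Otimes>\<^sub>M N i) (PiM (insert i I) N)"
    using measurable_add_dim[of i I N] by (simp add: case_prod_beta')
  have upd_space: "p(i := y) \<in> space (PiM (insert i I) N)"
    if "p \<in> space (PiM I N)" "y \<in> space (N i)" for p y
    using that by (auto simp: space_PiM PiE_def extensional_def)
  have slice: "(\<lambda>y. h (p(i := y))) \<in> borel_measurable (N i)"
    if h: "h \<in> borel_measurable (PiM (insert i I) N)" and p: "p \<in> space (PiM I N)"
    for h :: "('i \<Rightarrow> 'b) \<Rightarrow> real" and p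
    using measurable_compose[OF measurable_compose[OF measurable_Pair1'[OF p] upd] h] by simp
  have average: "(\<lambda>p. \<integral>y. h (p(i := y)) \<partial>N i) \<in> borel_measurable (PiM I N)"
    if h: "h \<in> borel_measurable (PiM (insert i I) N)" for h :: "('i \<Rightarrow> 'b) \<Rightarrow> real"
    using measurable_compose[OF upd h]
    by (intro Ni.borel_measurable_lebesgue_integral) (simp add: case_prod_beta')
  have bounded: "integrable (N i) (\<lambda>y. h (p(i := y)))"
    if "h \<in> borel_measurable (PiM (insert i I) N)" "\<And>q. h q \<in> {0..1}" "p \<in> space (PiM I N)"
    for h :: "('i \<Rightarrow> 'b) \<Rightarrow> real" and p
    using that slice by (intro Ni.integrable_const_bound[where B=1]) auto
  have range: "(\<integral>y. h (p(i := y)) \<partial>N i) \<in> {0..1}"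
    if "\<And>q. h q \<in> {0..1}" for h :: "('i \<Rightarrow> 'b) \<Rightarrow> real" and p
  proof -
    have "(\<integral>y. h (p(i := y)) \<partial>N i) \<le> 1"
    proof (cases "integrable (N i) (\<lambda>y. h (p(i := y)))")
      case True
      then show ?thesis using that Ni.integral_le_const[of "\<lambda>y. h (p(i := y))" 1] by auto
    qed (simp add: not_integrable_integral_eq)
    moreover have "0 \<le> (\<integral>y. h (p(i := y)) \<partial>N i)"
      using that by (intro integral_nonneg_AE) auto
    ultimately show ?thesis by simp
  qed
  have fold: "(\<integral>q. h q \<partial>PiM (insert i I) N) = (\<integral>p. (\<integral>y. h (p(i := y)) \<partial>N i) \<partial>PiM I N)"
    if "h \<in> borel_measurable (PiM (insert i I) N)" "\<And>q. h q \<in> {0..1}" for h :: "('i \<Rightarrow> 'b) \<Rightarrow> real"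
    using that insert.hyps
    by (intro product_integral_insert PJ.integrable_const_bound[where B=1]) auto
  note f = insert.prems(2,4,6) and g = insert.prems(3,5,7)
  have fg: "(\<lambda>p. f p * g p) \<in> borel_measurable (PiM (insert i I) N)" "\<And>p. f p * g p \<in> {0..1}"
    using f g by (auto intro: mult_le_one)
  let ?F = "\<lambda>p. \<integral>y. f (p(i := y)) \<partial>N i" and ?G = "\<lambda>p. \<integral>y. g (p(i := y)) \<partial>N i"
  have refl: "le j x x" if "j \<in> insert i I" "x \<in> space (N j)" for j x
    using insert.prems(1)[OF that that(2)] by blast
  have upd_mono: "h (p(i := x)) \<le> h (q(i := y))"
    if "increasing_on N le (insert i I) h" "p \<in> space (PiM I N)" "q \<in> space (PiM I N)"
      "\<forall>j\<in>I. le j (p j) (q j)" "x \<in> space (N i)" "y \<in> space (N i)" "le i x y" for h p q x y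
  proof (rule that(1)[unfolded increasing_on_def, rule_format])
    show "p(i := x) \<in> space (PiM (insert i I) N)" "q(i := y) \<in> space (PiM (insert i I) N)"
      using that by (auto intro: upd_space)
    show "le j ((p(i := x)) j) ((q(i := y)) j)" if "j \<in> insert i I" for j
      using that \<open>\<forall>j\<in>I. le j (p j) (q j)\<close> \<open>le i x y\<close> by auto
  qed
  have incr: "increasing_on N le I (\<lambda>p. \<integral>y. h (p(i := y)) \<partial>N i)"
    if h: "h \<in> borel_measurable (PiM (insert i I) N)" "\<And>q. h q \<in> {0..1}"
      "increasing_on N le (insert i I) h" for h
    unfolding increasing_on_def
    by (intro ballI impI Bochner_Integration.integral_mono bounded[OF h(1,2)] upd_mono[OF h(3)] refl)
      simp_all
  have "(\<integral>p. f p \<partial>PiM (insert i I) N) * (\<integral>p. g p \<partial>PiM (insert i I) N)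
      = (\<integral>p. ?F p \<partial>PiM I N) * (\<integral>p. ?G p \<partial>PiM I N)"
    using f g by (simp add: fold)
  also have "\<dots> \<le> (\<integral>p. ?F p * ?G p \<partial>PiM I N)"
  proof (rule insert.IH)
    show "le j x y \<or> le j y x" if "j \<in> I" "x \<in> space (N j)" "y \<in> space (N j)" for j x y
      using insert.prems(1) that by blast
    show "?F p \<in> {0..1}" "?G p \<in> {0..1}" for p
      by (rule range, rule f(2), rule range, rule g(2))
  qed (rule average[OF f(1)] average[OF g(1)] incr[OF f] incr[OF g])+
  also have "\<dots> \<le> (\<integral>p. (\<integral>y. f (p(i := y)) * g (p(i := y)) \<partial>N i) \<partial>PiM I N)"
  proof (rule Bochner_Integration.integral_mono)
    show "integrable (PiM I N) (\<lambda>p. ?F p * ?G p)"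
    proof (rule PI.integrable_const_bound[where B=1])
      have "\<bar>?F p * ?G p\<bar> \<le> 1" for p
        using range[of f p, OF f(2)] range[of g p, OF g(2)]
        by (simp add: abs_mult mult_le_one)
      then show "AE p in PiM I N. norm (?F p * ?G p) \<le> 1" unfolding real_norm_def by (intro AE_I2)
    qed (intro borel_measurable_times average f(1) g(1))
    show "integrable (PiM I N) (\<lambda>p. \<integral>y. f (p(i := y)) * g (p(i := y)) \<partial>N i)"
    proof (rule PI.integrable_const_bound[where B=1])
      have "norm (\<integral>y. f (p(i := y)) * g (p(i := y)) \<partial>N i) \<le> 1" for p
        using range[of "\<lambda>p. f p * g p" p, OF fg(2)] unfolding atLeastAtMost_iff real_norm_def by linarith
      then show "AE p in PiM I N. norm (\<integral>y. f (p(i := y)) * g (p(i := y)) \<partial>N i) \<le> 1" by (intro AE_I2)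
    qed (rule average[OF fg(1)])
  next
    fix p assume p: "p \<in> space (PiM I N)"
    have p_refl: "\<forall>j\<in>I. le j (p j) (p j)"
      using p by (auto simp: space_PiM intro!: refl dest: PiE_mem)
    have "0 \<le> (f (p(i := x)) - f (p(i := y))) * (g (p(i := x)) - g (p(i := y)))"
      if xy: "x \<in> space (N i)" "y \<in> space (N i)" for x y
      using insert.prems(1)[OF insertI1 xy]
    proof
      assume "le i x y"
      then show ?thesis
        using upd_mono[OF f(3) p p p_refl xy] upd_mono[OF g(3) p p p_refl xy]
        by (intro mult_nonpos_nonpos) (simp_all only: diff_le_0_iff_le)
    next
      assume "le i y x"
      then show ?thesis
        using upd_mono[OF f(3) p p p_refl xy(2,1)] upd_mono[OF g(3) p p p_refl xy(2,1)]
        by (intro mult_nonneg_nonneg) (simp_all only: diff_ge_0_iff_ge)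
    qed
    then show "?F p * ?G p \<le> (\<integral>y. f (p(i := y)) * g (p(i := y)) \<partial>N i)"
      by (intro Ni.comonotone_integral_mult bounded[OF f(1,2) p] bounded[OF g(1,2) p] bounded[OF fg p])
  qed
  also have "\<dots> = (\<integral>p. f p * g p \<partial>PiM (insert i I) N)"
    by (rule fold[OF fg, symmetric])
  finally show ?case .
qed

text \<open>Finitely many independent variables have a product law, so the Harris inequality for indicator
  functions becomes one for probabilities.\<close>

lemma (in prob_space) harris_indep_vars:
  fixes Y :: "'i \<Rightarrow> 'a \<Rightarrow> 'b"
  assumes indep: "indep_vars N Y I" and fin: "finite I"
    and total: "\<And>i x y. i \<in> I \<Longrightarrow> x \<in> space (N i) \<Longrightarrow> y \<in> space (N i) \<Longrightarrow> le i x y \<or> le i y x"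
    and meas: "Measurable.pred (PiM I N) A" "Measurable.pred (PiM I N) B"
    and up: "\<And>p q. p \<in> space (PiM I N) \<Longrightarrow> q \<in> space (PiM I N) \<Longrightarrow> (\<forall>i\<in>I. le i (p i) (q i)) \<Longrightarrow> A p \<Longrightarrow> A q"
      "\<And>p q. p \<in> space (PiM I N) \<Longrightarrow> q \<in> space (PiM I N) \<Longrightarrow> (\<forall>i\<in>I. le i (p i) (q i)) \<Longrightarrow> B p \<Longrightarrow> B q"
  defines "Z \<equiv> \<lambda>\<omega>. \<lambda>i\<in>I. Y i \<omega>"
  shows "\<P>(\<omega> in M. A (Z \<omega>)) * \<P>(\<omega> in M. B (Z \<omega>)) \<le> \<P>(\<omega> in M. A (Z \<omega>) \<and> B (Z \<omega>))"
proof (cases "I = {}")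
  case True
  \<comment> \<open>There is only one configuration, so both events are trivial.\<close>
  then have "Z = (\<lambda>_ _. undefined)" by (simp add: Z_def fun_eq_iff)
  then show ?thesis
    by (cases "A (\<lambda>_. undefined)"; cases "B (\<lambda>_. undefined)") (simp_all add: prob_space)
next
  case False
  have rv: "random_variable (N i) (Y i)" if "i \<in> I" for i
    using indep that by (auto simp: indep_vars_def)
  \<comment> \<open>Coordinates outside \<open>I\<close> get an arbitrary law, since product measures are formed from a total family.\<close>
  define D where "D i = (if i \<in> I then distr M (N i) (Y i) else return (count_space UNIV) undefined)" for i
  have D: "prob_space (D i)" for i
    by (auto simp: D_def intro!: prob_space_return prob_space_distr rv)
  have sets: "sets (PiM I D) = sets (PiM I N)"
    by (intro sets_PiM_cong) (auto simp: D_def)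
  then have space: "space (PiM I D) = space (PiM I N)" by (rule sets_eq_imp_space_eq)
  have Z: "Z \<in> measurable M (PiM I N)"
    unfolding Z_def by (intro measurable_restrict rv)
  have law: "distr M (PiM I N) Z = PiM I D"
  proof -
    have "distr M (PiM I N) Z = PiM I (\<lambda>i. distr M (N i) (Y i))"
      unfolding Z_def using indep_vars_iff_distr_eq_PiM'[OF False rv] indep by simp
    also have "\<dots> = PiM I D" by (intro PiM_cong) (auto simp: D_def)
    finally show ?thesis .
  qed
  have prob_eq: "(\<integral>p. indicator {p. P p} p \<partial>PiM I D) = \<P>(\<omega> in M. P (Z \<omega>))"
    if P: "Measurable.pred (PiM I N) P" for P
  proof -
    have "(\<integral>p. indicator {p. P p} p \<partial>PiM I D) = (\<integral>\<omega>. indicator {p. P p} (Z \<omega>) \<partial>M :: real)"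
      unfolding law[symmetric] using P
      by (intro integral_distr Z) (simp add: borel_measurable_indicator_iff pred_def Int_def conj_commute)
    also have "\<dots> = (\<integral>\<omega>. indicator {\<omega>\<in>space M. P (Z \<omega>)} \<omega> \<partial>M)"
      by (intro Bochner_Integration.integral_cong) (auto simp: indicator_def)
    finally show ?thesis by (simp add: Int_absorb2 subset_eq)
  qed
  have up': "increasing_on D le I (indicator {p. P p})"
    if "\<And>p q. p \<in> space (PiM I N) \<Longrightarrow> q \<in> space (PiM I N) \<Longrightarrow> (\<forall>i\<in>I. le i (p i) (q i)) \<Longrightarrow> P p \<Longrightarrow> P q"
    for P using that unfolding increasing_on_def space by (auto simp: indicator_def)
  have ind: "(indicator {p. P p} :: _ \<Rightarrow> real) \<in> borel_measurable (PiM I D)"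
    if "Measurable.pred (PiM I N) P" for P
    using that unfolding measurable_cong_sets[OF sets refl]
    by (simp add: borel_measurable_indicator_iff pred_def Int_def conj_commute)
  have "\<P>(\<omega> in M. A (Z \<omega>)) * \<P>(\<omega> in M. B (Z \<omega>))
    = (\<integral>p. indicator {p. A p} p \<partial>PiM I D) * (\<integral>p. indicator {p. B p} p \<partial>PiM I D)"
    by (simp only: prob_eq[OF meas(1)] prob_eq[OF meas(2)])
  also have "\<dots> \<le> (\<integral>p. indicator {p. A p} p * indicator {p. B p} p \<partial>PiM I D)"
  proof (rule harris_PiM[where le=le, OF fin D])
    show "le i x y \<or> le i y x" if "i \<in> I" "x \<in> space (D i)" "y \<in> space (D i)" for i x y
      using total[of i x y] that by (simp add: D_def)
  qed (rule ind[OF meas(1)], rule ind[OF meas(2)], simp, simp, rule up'[OF up(1)], assumption+, rule up'[OF up(2)], assumption+)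
  also have "\<dots> = (\<integral>p. indicator {p. A p \<and> B p} p \<partial>PiM I D)"
    by (intro Bochner_Integration.integral_cong) (auto simp: indicator_def)
  also have "\<dots> = \<P>(\<omega> in M. A (Z \<omega>) \<and> B (Z \<omega>))"
    using meas by (intro prob_eq) auto
  finally show ?thesis .
qed

text \<open>Dominated convergence for indicators, in the form in which finite approximations are replaced by
  their limits.\<close>

lemma (in prob_space) prob_tendsto_AE:
  assumes "\<And>n. Measurable.pred M (A n)" "Measurable.pred M B"
    and "AE \<omega> in M. \<forall>\<^sub>F n in sequentially. A n \<omega> \<longleftrightarrow> B \<omega>"
  shows "(\<lambda>n. \<P>(\<omega> in M. A n \<omega>)) \<longlonglongrightarrow> \<P>(\<omega> in M. B \<omega>)"
proof -
  have meas: "(indicator {\<omega>\<in>space M. P \<omega>} :: _ \<Rightarrow> real) \<in> borel_measurable M"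
    if "Measurable.pred M P" for P
    using that by measurable
  have "(\<lambda>n. \<integral>\<omega>. indicator {\<omega>\<in>space M. A n \<omega>} \<omega> \<partial>M)
      \<longlonglongrightarrow> (\<integral>\<omega>. indicator {\<omega>\<in>space M. B \<omega>} \<omega> \<partial>M :: real)"
  proof (rule integral_dominated_convergence[where w="\<lambda>_. 1"])
    show "AE \<omega> in M. (\<lambda>n. indicator {\<omega>\<in>space M. A n \<omega>} \<omega>)
        \<longlonglongrightarrow> (indicator {\<omega>\<in>space M. B \<omega>} \<omega> :: real)"
      using assms(3)
      by eventually_elim (auto intro!: tendsto_eventually elim!: eventually_mono simp: indicator_def)
  qed (use assms in \<open>auto intro!: meas simp: indicator_def\<close>)
  then show ?thesis by (simp add: Int_absorb2 subset_eq)
qed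

section \<open>Blocking rules\<close>

text \<open>Success \<open>Z\<close> of the items in \<open>S\<close> with arrival times \<open>T\<close>, where \<open>R j i\<close> means that \<open>j\<close> blocks \<open>i\<close>.
  An item with time \<open>\<infinity>\<close> never arrives. This is a predicate rather than a recursive function: on
  finite \<open>S\<close> it determines \<open>Z\<close>, and all that is used about the processes is that they satisfy it.\<close>

definition blocking_solution ::
    "('i \<Rightarrow> 'i \<Rightarrow> bool) \<Rightarrow> 'i set \<Rightarrow> ('i \<Rightarrow> ereal) \<Rightarrow> ('i \<Rightarrow> bool) \<Rightarrow> bool" where
  "blocking_solution R S T Z \<longleftrightarrow>
     (\<forall>i\<in>S. Z i \<longleftrightarrow> T i < \<infinity> \<and> (\<forall>j\<in>S. R j i \<and> T j < T i \<longrightarrow> \<not> Z j))"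

text \<open>Only finitely many values of \<open>m\<close> occur, so the number of elements with smaller values can be used for
  complete induction.\<close>

lemma finite_linear_induct [consumes 2, case_names step]:
  fixes m :: "'i \<Rightarrow> 'l::linorder"
  assumes "finite S" "i \<in> S"
    and step: "\<And>i. i \<in> S \<Longrightarrow> (\<And>j. j \<in> S \<Longrightarrow> m j < m i \<Longrightarrow> P j) \<Longrightarrow> P i"
  shows "P i"
  using \<open>i \<in> S\<close>
proof (induction "card {j\<in>S. m j < m i}" arbitrary: i rule: less_induct)
  case less
  have "card {l\<in>S. m l < m j} < card {l\<in>S. m l < m i}" if "j \<in> S" "m j < m i" for j
    using that assms(1) by (intro psubset_card_mono) auto
  then show ?case using less step by blast
qed

text \<open>The core of the argument, by induction along the smaller of the two arrival times. If a favoured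
  \<open>i\<close> that succeeded under \<open>T\<close> had a successful blocker \<open>j\<close> under \<open>T'\<close>, then \<open>j\<close> is not favoured, so by
  induction it succeeded under \<open>T\<close> as well, and
  \<open>T j \<le> T' j < T' i \<le> T i\<close> shows that it would have blocked \<open>i\<close> there. The other class is symmetric.\<close>

lemma blocking_solution_mono:
  assumes "finite S"
    and sol: "blocking_solution R S T Z" "blocking_solution R S T' Z'"
    and alternate: "\<And>i j. i \<in> S \<Longrightarrow> j \<in> S \<Longrightarrow> R j i \<Longrightarrow> favoured j \<longleftrightarrow> \<not> favoured i"
    and earlier: "\<And>i. i \<in> S \<Longrightarrow> favoured i \<Longrightarrow> T' i \<le> T i"
    and later: "\<And>i. i \<in> S \<Longrightarrow> \<not> favoured i \<Longrightarrow> T i \<le> T' i"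
    and "i \<in> S"
  shows "if favoured i then Z i \<longrightarrow> Z' i else Z' i \<longrightarrow> Z i"
  using assms(1) \<open>i \<in> S\<close>
proof (induction i rule: finite_linear_induct[where m="\<lambda>i. min (T i) (T' i)"])
  case (step i)
  have Z: "Z j \<longleftrightarrow> T j < \<infinity> \<and> (\<forall>l\<in>S. R l j \<and> T l < T j \<longrightarrow> \<not> Z l)"
    and Z': "Z' j \<longleftrightarrow> T' j < \<infinity> \<and> (\<forall>l\<in>S. R l j \<and> T' l < T' j \<longrightarrow> \<not> Z' l)" if "j \<in> S" for j
    using sol that unfolding blocking_solution_def by blast+
  show ?case
  proof (cases "favoured i")
    case True
    have "Z' i" if "Z i"
      unfolding Z'[OF step(1)]
    proof (intro conjI ballI impI notI)
      show "T' i < \<infinity>" using \<open>Z i\<close> Z[OF step(1)] by (blast intro: le_less_trans[OF earlier[OF step(1) True]])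
      fix j assume j: "j \<in> S" "R j i \<and> T' j < T' i" "Z' j"
      then have cls: "\<not> favoured j" and le: "T j \<le> T' j" "T' i \<le> T i"
        using alternate step(1) True earlier later by blast+
      have lt: "T j < T' i" using le(1) j(2)[THEN conjunct2] by order
      then have "min (T j) (T' j) < min (T i) (T' i)"
        using le by (simp add: min_absorb1 min_absorb2)
      then have "Z j" using step(2)[OF j(1)] cls j(3) by simp
      moreover have "T j < T i" using lt le(2) by order
      ultimately show False using \<open>Z i\<close> Z[OF step(1)] j by blast
    qed
    then show ?thesis using True by simp
  next
    case False
    have "Z i" if "Z' i"
      unfolding Z[OF step(1)]
    proof (intro conjI ballI impI notI)
      show "T i < \<infinity>" using \<open>Z' i\<close> Z'[OF step(1)] by (blast intro: le_less_trans[OF later[OF step(1) False]])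
      fix j assume j: "j \<in> S" "R j i \<and> T j < T i" "Z j"
      then have cls: "favoured j" and le: "T' j \<le> T j" "T i \<le> T' i"
        using alternate step(1) False earlier later by blast+
      have lt: "T' j < T i" using le(1) j(2)[THEN conjunct2] by order
      then have "min (T j) (T' j) < min (T i) (T' i)"
        using le by (simp add: min_absorb1 min_absorb2)
      then have "Z' j" using step(2)[OF j(1)] cls j(3) by simp
      moreover have "T' j < T' i" using lt le(2) by order
      ultimately show False using \<open>Z' i\<close> Z'[OF step(1)] j by blast
    qed
    then show ?thesis using False by simp
  qed
qed

text \<open>Iterating the blocking rule from the empty set stabilises at an item once there are more rounds than
  items with earlier times. This makes the solution an explicit Boolean combination of comparisons of
  arrival times, and thereby measurable.\<close>

primrec blocking_approx :: "('i \<Rightarrow> 'i \<Rightarrow> bool) \<Rightarrow> 'i set \<Rightarrow> ('i \<Rightarrow> ereal) \<Rightarrow> nat \<Rightarrow> 'i \<Rightarrow> bool" where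
  "blocking_approx R S T 0 i \<longleftrightarrow> False"
| "blocking_approx R S T (Suc n) i \<longleftrightarrow>
     T i < \<infinity> \<and> (\<forall>j\<in>S. R j i \<and> T j < T i \<longrightarrow> \<not> blocking_approx R S T n j)"

lemma blocking_solution_eq_approx:
  assumes "finite S" "blocking_solution R S T Z" "i \<in> S" "card {j\<in>S. T j < T i} < n"
  shows "Z i \<longleftrightarrow> blocking_approx R S T n i"
  using assms(3,4)
proof (induction n arbitrary: i)
  case (Suc n)
  have "card {l\<in>S. T l < T j} < n" if "j \<in> S" "T j < T i" for j
  proof -
    have "card {l\<in>S. T l < T j} < card {l\<in>S. T l < T i}"
      using that assms(1) by (intro psubset_card_mono) auto
    then show ?thesis using Suc.prems by simp
  qed
  moreover have "Z i \<longleftrightarrow> T i < \<infinity> \<and> (\<forall>j\<in>S. R j i \<and> T j < T i \<longrightarrow> \<not> Z j)"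
    using assms(2) Suc.prems by (auto simp: blocking_solution_def)
  ultimately show ?case using Suc.IH by auto
qed simp

lemma measurable_blocking_solution:
  assumes "finite S" and T: "\<And>i. i \<in> S \<Longrightarrow> (\<lambda>\<omega>. T \<omega> i) \<in> borel_measurable M"
    and sol: "\<And>\<omega>. \<omega> \<in> space M \<Longrightarrow> blocking_solution R S (T \<omega>) (Z \<omega>)" and "i \<in> S"
  shows "Measurable.pred M (\<lambda>\<omega>. Z \<omega> i)"
proof -
  have "Measurable.pred M (\<lambda>\<omega>. blocking_approx R S (T \<omega>) n i)" if "i \<in> S" for n i
    using that
  proof (induction n arbitrary: i)
    case (Suc n)
    have [measurable]: "(\<lambda>\<omega>. T \<omega> i) \<in> borel_measurable M" by (rule T[OF Suc.prems])
    have "Measurable.pred M (\<lambda>\<omega>. R j i \<and> T \<omega> j < T \<omega> i \<longrightarrow> \<not> blocking_approx R S (T \<omega>) n j)"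
      if "j \<in> S" for j
    proof -
      have [measurable]: "(\<lambda>\<omega>. T \<omega> j) \<in> borel_measurable M" by (rule T[OF that])
      have [measurable]: "Measurable.pred M (\<lambda>\<omega>. blocking_approx R S (T \<omega>) n j)"
        by (rule Suc.IH[OF that])
      show ?thesis by measurable
    qed
    then show ?case using assms(1) by (simp add: pred_intros_finite)
  qed simp
  then have "Measurable.pred M (\<lambda>\<omega>. blocking_approx R S (T \<omega>) (Suc (card S)) i)"
    using \<open>i \<in> S\<close> by blast
  moreover have eq: "Z \<omega> i \<longleftrightarrow> blocking_approx R S (T \<omega>) (Suc (card S)) i" if "\<omega> \<in> space M" for \<omega>
    using assms(1,4) sol[OF that]
    by (intro blocking_solution_eq_approx) (auto simp: less_Suc_eq_le intro!: card_mono)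
  ultimately show ?thesis by (intro measurable_cong[OF eq, THEN iffD2])
qed

text \<open>Along sets \<open>S' x\<close> that exhaust \<open>S\<close>, an item eventually sees all its blockers in \<open>S\<close>; these are finitely
  many and their outcomes are eventually constant by well-founded induction.\<close>

lemma blocking_solutions_converge:
  assumes wf: "wf {(j, i). i \<in> S \<and> j \<in> S \<and> R j i \<and> T j < T i \<and> T i < \<infinity>}"
    and locally_finite: "\<And>i. i \<in> S \<Longrightarrow> finite {j\<in>S. R j i}"
    and sol: "\<forall>\<^sub>F x in G. blocking_solution R (S' x) T (Z x)"
    and sub: "\<forall>\<^sub>F x in G. S' x \<subseteq> S"
    and exhaust: "\<And>i. i \<in> S \<Longrightarrow> \<forall>\<^sub>F x in G. i \<in> S' x"
    and "i \<in> S"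
  shows "\<exists>b. \<forall>\<^sub>F x in G. Z x i = b"
  using wf \<open>i \<in> S\<close>
proof (induction i rule: wf_induct_rule)
  case (less i)
  show ?case
  proof (cases "T i < \<infinity>")
    case False
    have "\<forall>\<^sub>F x in G. Z x i = False"
      using sol exhaust[OF less.prems]
      by eventually_elim (use False in \<open>auto simp: blocking_solution_def\<close>)
    then show ?thesis by blast
  next
    case True
    define J where "J = {j\<in>S. R j i \<and> T j < T i}"
    have fin: "finite J" using locally_finite[OF less.prems] unfolding J_def by (rule rev_finite_subset) auto
    have "\<forall>j\<in>J. \<exists>b. \<forall>\<^sub>F x in G. Z x j = b" using less True by (auto simp: J_def)
    then obtain b where "\<And>j. j \<in> J \<Longrightarrow> \<forall>\<^sub>F x in G. Z x j = b j" by metis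
    then have "\<forall>\<^sub>F x in G. \<forall>j\<in>J. Z x j = b j" using fin by (simp add: eventually_ball_finite_distrib)
    moreover have "\<forall>\<^sub>F x in G. \<forall>j\<in>J. j \<in> S' x"
      using fin exhaust by (simp add: eventually_ball_finite_distrib) (simp add: J_def)
    ultimately have "\<forall>\<^sub>F x in G. Z x i = (\<forall>j\<in>J. \<not> b j)"
      using sol sub exhaust[OF less.prems]
    proof eventually_elim
      case (elim x)
      then have "Z x i \<longleftrightarrow> (\<forall>j\<in>S' x. R j i \<and> T j < T i \<longrightarrow> \<not> Z x j)"
        using True by (auto simp: blocking_solution_def)
      then show ?case using elim unfolding J_def by blast
    qed
    then show ?thesis by blast
  qed
qed

section \<open>Folding updates over increasing times\<close>

lemma sorted_list_of_set_insert_greatest: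
  assumes "finite B" "\<forall>b\<in>B. b < s"
  shows "sorted_list_of_set (insert s B) = sorted_list_of_set B @ [s]"
  using assms
  by (intro sorted_list_of_set_unique[THEN iffD1])
    (auto simp: strict_sorted_iff sorted_append sorted_wrt_append card_insert_if less_imp_le)

text \<open>The states of the processes before and at time \<open>t\<close> both arise from the updates at an initial
  segment of the arrival times, so an invariant of initial segments covers both.\<close>

lemma finite_initial_segment_induct [consumes 1, case_names empty insert]:
  fixes A :: "'l::linorder set"
  assumes "finite A" "P {}"
    and insert: "\<And>s. s \<in> A \<Longrightarrow> P {r\<in>A. r < s} \<Longrightarrow> P (insert s {r\<in>A. r < s})"
  shows "P {r\<in>A. r \<le> t}" "P {r\<in>A. r < t}"
proof -
  have "P B" if "B \<subseteq> A" "\<And>r s. r \<in> A \<Longrightarrow> s \<in> B \<Longrightarrow> r \<le> s \<Longrightarrow> r \<in> B" for B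
    using finite_subset[OF that(1) assms(1)] that
  proof (induction B rule: finite_linorder_max_induct)
    case (insert s B)
    have B: "B = {r\<in>A. r < s}"
      using insert.hyps(2) insert.prems(1,2) by force
    have "P B"
      using insert.prems insert.hyps(2) by (intro insert.IH) force+
    then show ?case using assms(3)[of s] insert.prems(1) B by auto
  qed (rule assms(2))
  note segment = this
  show "P {r\<in>A. r \<le> t}" by (rule segment) (auto intro: order_trans)
  show "P {r\<in>A. r < t}" by (rule segment) (auto intro: le_less_trans)
qed

section \<open>Random sequential adsorption as a blocking rule\<close>

definition rsa_before :: "'a set set \<Rightarrow> ('a \<Rightarrow> real) \<Rightarrow> 'a set \<Rightarrow> real \<Rightarrow> 'a \<Rightarrow> nat" where
  "rsa_before E \<tau> U s = fold (rsa_update E U \<tau>) (sorted_list_of_set {r \<in> \<tau> ` U. r < s}) (\<lambda>v. 0)"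

definition rsa_accepts :: "'a set set \<Rightarrow> ('a \<Rightarrow> real) \<Rightarrow> 'a set \<Rightarrow> 'a \<Rightarrow> bool" where
  "rsa_accepts E \<tau> U v \<longleftrightarrow> (\<forall>u\<in>U. {u, v} \<in> E \<longrightarrow> rsa_before E \<tau> U (\<tau> v) u = 0)"

text \<open>Before its own arrival a site is vacant, and afterwards it keeps the state decided at its arrival.\<close>

lemma
  assumes "finite U"
  shows finite_rsa_eq: "finite_rsa E \<tau> U t v = (if v \<in> U \<and> \<tau> v \<le> t \<and> rsa_accepts E \<tau> U v then 1 else 0)"
    and rsa_before_eq: "rsa_before E \<tau> U t v = (if v \<in> U \<and> \<tau> v < t \<and> rsa_accepts E \<tau> U v then 1 else 0)"
proof -
  let ?run = "\<lambda>B. fold (rsa_update E U \<tau>) (sorted_list_of_set B) (\<lambda>v. 0 :: nat)"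
  let ?P = "\<lambda>B. \<forall>v. ?run B v = (if v \<in> U \<and> \<tau> v \<in> B \<and> rsa_accepts E \<tau> U v then 1 else 0)"
  have fin: "finite (\<tau> ` U)" using assms by simp
  have step: "?P (insert s {r\<in>\<tau> ` U. r < s})" if "?P {r\<in>\<tau> ` U. r < s}" for s
  proof -
    have "?run (insert s {r\<in>\<tau> ` U. r < s}) = rsa_update E U \<tau> s (?run {r\<in>\<tau> ` U. r < s})"
      using fin by (subst sorted_list_of_set_insert_greatest) auto
    also have "\<dots> = rsa_update E U \<tau> s (rsa_before E \<tau> U s)" by (simp add: rsa_before_def)
    finally show ?thesis
      using that by (auto simp: rsa_update_def rsa_accepts_def rsa_before_def)
  qed
  have "?P {r\<in>\<tau> ` U. r \<le> t}" "?P {r\<in>\<tau> ` U. r < t}"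
    by (rule finite_initial_segment_induct[OF fin], simp, rule step, assumption)+
  then show "finite_rsa E \<tau> U t v = (if v \<in> U \<and> \<tau> v \<le> t \<and> rsa_accepts E \<tau> U v then 1 else 0)"
    "rsa_before E \<tau> U t v = (if v \<in> U \<and> \<tau> v < t \<and> rsa_accepts E \<tau> U v then 1 else 0)"
    by (auto simp: finite_rsa_def rsa_before_def)
qed

lemma rsa_blocking_solution:
  assumes "finite U"
  shows "blocking_solution (\<lambda>u v. {u, v} \<in> E) U (\<lambda>v. ereal (\<tau> v)) (rsa_accepts E \<tau> U)"
  unfolding blocking_solution_def
proof
  fix v
  have "rsa_accepts E \<tau> U v \<longleftrightarrow>
      (\<forall>u\<in>U. {u, v} \<in> E \<longrightarrow> \<not> (\<tau> u < \<tau> v \<and> rsa_accepts E \<tau> U u))"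
    by (subst rsa_accepts_def) (auto simp: rsa_before_eq[OF assms])
  then show "rsa_accepts E \<tau> U v \<longleftrightarrow> ereal (\<tau> v) < \<infinity> \<and>
      (\<forall>u\<in>U. {u, v} \<in> E \<and> ereal (\<tau> u) < ereal (\<tau> v) \<longrightarrow> \<not> rsa_accepts E \<tau> U u)"
    by simp blast
qed

section \<open>Annihilation as a blocking rule on directed edges\<close>

definition annihilation_before ::
    "'a set set \<Rightarrow> ('a set \<Rightarrow> real) \<Rightarrow> ('a set \<Rightarrow> 'a) \<Rightarrow> 'a set \<Rightarrow> real \<Rightarrow> 'a \<Rightarrow> nat" where
  "annihilation_before E \<sigma> \<alpha> U s = fold (annihilation_update E U \<sigma> \<alpha>)
     (sorted_list_of_set {r \<in> \<sigma> ` induced_edges E U. r < s}) (\<lambda>v. 1)"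

definition attacks :: "'a set \<times> 'a \<Rightarrow> 'a set \<times> 'a \<Rightarrow> bool" where
  "attacks = (\<lambda>(e', x') (e, x). x' \<in> e \<and> x' \<noteq> x)"

text \<open>The pair \<open>(e, x)\<close> stands for an attack along \<open>e\<close> on its endpoint \<open>x\<close>.\<close>

definition directed_edges :: "'a set set \<Rightarrow> ('a set \<times> 'a) set" where
  "directed_edges E = {(e, x). e \<in> E \<and> x \<in> e}"

definition attack_time :: "('a set \<Rightarrow> real) \<Rightarrow> ('a set \<Rightarrow> 'a) \<Rightarrow> 'a set \<times> 'a \<Rightarrow> ereal" where
  "attack_time \<sigma> \<alpha> = (\<lambda>(e, x). if \<alpha> e = x then ereal (\<sigma> e) else \<infinity>)"

text \<open>The bounded quantifier only ranges over the attacker, which is the other endpoint of \<open>e\<close>. An armed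
  attack on a vacant site leaves it vacant.\<close>

definition attack_armed ::
    "'a set set \<Rightarrow> ('a set \<Rightarrow> real) \<Rightarrow> ('a set \<Rightarrow> 'a) \<Rightarrow> 'a set \<Rightarrow> 'a set \<times> 'a \<Rightarrow> bool" where
  "attack_armed E \<sigma> \<alpha> U = (\<lambda>(e, x). \<alpha> e = x \<and>
     (\<forall>u\<in>e. u \<noteq> x \<longrightarrow> annihilation_before E \<sigma> \<alpha> U (\<sigma> e) u = 1))"

text \<open>An attack by an occupied site leaves its target vacant, no matter whether the target was occupied, so
  the vacant sites are the targets of armed attacks so far.\<close>

lemma
  assumes fin: "finite (induced_edges E U)" and \<alpha>: "\<forall>e\<in>induced_edges E U. \<alpha> e \<in> e"
  shows finite_annihilation_eq: "finite_annihilation E \<sigma> \<alpha> U t v =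
      (if \<exists>e\<in>induced_edges E U. v \<in> e \<and> attack_time \<sigma> \<alpha> (e, v) \<le> ereal t \<and> attack_armed E \<sigma> \<alpha> U (e, v) then 0 else 1)"
    and annihilation_before_eq: "annihilation_before E \<sigma> \<alpha> U t v =
      (if \<exists>e\<in>induced_edges E U. v \<in> e \<and> attack_time \<sigma> \<alpha> (e, v) < ereal t \<and> attack_armed E \<sigma> \<alpha> U (e, v) then 0 else 1)"
proof -
  let ?A = "\<sigma> ` induced_edges E U"
  let ?run = "\<lambda>B. fold (annihilation_update E U \<sigma> \<alpha>) (sorted_list_of_set B) (\<lambda>v. 1 :: nat)"
  let ?P = "\<lambda>B. \<forall>v. ?run B v =
    (if \<exists>e\<in>induced_edges E U. \<alpha> e = v \<and> \<sigma> e \<in> B \<and> attack_armed E \<sigma> \<alpha> U (e, v) then 0 else 1)"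
  have step: "?P (insert s {r\<in>?A. r < s})" if IH: "?P {r\<in>?A. r < s}" for s
  proof
    fix v
    let ?\<eta> = "annihilation_before E \<sigma> \<alpha> U s"
    have run: "?run {r\<in>?A. r < s} = ?\<eta>" by (simp add: annihilation_before_def)
    have "?run (insert s {r\<in>?A. r < s}) = annihilation_update E U \<sigma> \<alpha> s ?\<eta>"
      using fin run by (subst sorted_list_of_set_insert_greatest) auto
    moreover have "annihilation_update E U \<sigma> \<alpha> s ?\<eta> v = 0 \<longleftrightarrow>
        ?\<eta> v = 0 \<or> (\<exists>e\<in>induced_edges E U. \<alpha> e = v \<and> \<sigma> e = s \<and> attack_armed E \<sigma> \<alpha> U (e, v))"
    \<comment> \<open>If \<open>v\<close> is already vacant, it stays so, and an attack on it changes nothing.\<close>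
    proof (cases "?\<eta> v = 0")
      case False
      then have "?\<eta> v = 1" using IH unfolding run by (auto split: if_splits)
      then show ?thesis using False
        unfolding annihilation_update_def attack_armed_def by auto metis
    qed (simp add: annihilation_update_def)
    moreover have "annihilation_update E U \<sigma> \<alpha> s ?\<eta> v \<in> {0, 1}"
      using IH[rule_format, of v] unfolding run by (auto simp: annihilation_update_def)
    moreover have "?\<eta> v = 0 \<longleftrightarrow>
        (\<exists>e\<in>induced_edges E U. \<alpha> e = v \<and> \<sigma> e < s \<and> attack_armed E \<sigma> \<alpha> U (e, v))"
      using IH[rule_format, of v] unfolding run by (auto split: if_splits)
    ultimately show "?run (insert s {r\<in>?A. r < s}) v =
        (if \<exists>e\<in>induced_edges E U. \<alpha> e = v \<and> \<sigma> e \<in> insert s {r\<in>?A. r < s} \<and> attack_armed E \<sigma> \<alpha> U (e, v) then 0 else 1)"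
      by auto
  qed
  have finA: "finite ?A" using fin by simp
  have P: "?P {r\<in>?A. r \<le> t}" "?P {r\<in>?A. r < t}"
    by (rule finite_initial_segment_induct[OF finA], simp, rule step, assumption)+
  show "finite_annihilation E \<sigma> \<alpha> U t v =
      (if \<exists>e\<in>induced_edges E U. v \<in> e \<and> attack_time \<sigma> \<alpha> (e, v) \<le> ereal t \<and> attack_armed E \<sigma> \<alpha> U (e, v) then 0 else 1)"
    using P(1)[rule_format, of v] \<alpha> unfolding finite_annihilation_def
    by (simp add: attack_time_def attack_armed_def) metis
  show "annihilation_before E \<sigma> \<alpha> U t v =
      (if \<exists>e\<in>induced_edges E U. v \<in> e \<and> attack_time \<sigma> \<alpha> (e, v) < ereal t \<and> attack_armed E \<sigma> \<alpha> U (e, v) then 0 else 1)"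
    using P(2)[rule_format, of v] \<alpha> unfolding annihilation_before_def[of E \<sigma> \<alpha> U t]
    by (simp add: attack_time_def attack_armed_def) metis
qed

lemma annihilation_blocking_solution:
  assumes fin: "finite (induced_edges E U)" and \<alpha>: "\<forall>e\<in>induced_edges E U. \<alpha> e \<in> e"
  shows "blocking_solution attacks (directed_edges (induced_edges E U)) (attack_time \<sigma> \<alpha>)
           (attack_armed E \<sigma> \<alpha> U)"
  unfolding blocking_solution_def
proof (intro ballI, clarify)
  fix e x assume "(e, x) \<in> directed_edges (induced_edges E U)"
  have "attack_armed E \<sigma> \<alpha> U (e, x) \<longleftrightarrow> \<alpha> e = x \<and> (\<forall>u\<in>e. u \<noteq> x \<longrightarrow>
      \<not> (\<exists>e'\<in>induced_edges E U. u \<in> e' \<and> attack_time \<sigma> \<alpha> (e', u) < ereal (\<sigma> e) \<and> attack_armed E \<sigma> \<alpha> U (e', u)))"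
    by (subst attack_armed_def) (auto simp: annihilation_before_eq[OF fin \<alpha>])
  then show "attack_armed E \<sigma> \<alpha> U (e, x) \<longleftrightarrow> attack_time \<sigma> \<alpha> (e, x) < \<infinity> \<and>
      (\<forall>j\<in>directed_edges (induced_edges E U).
        attacks j (e, x) \<and> attack_time \<sigma> \<alpha> j < attack_time \<sigma> \<alpha> (e, x) \<longrightarrow> \<not> attack_armed E \<sigma> \<alpha> U j)"
    by (auto simp: attack_time_def attacks_def directed_edges_def)
qed

section \<open>Independent uniform times on a graph of bounded degree\<close>

primrec walks :: "('i \<Rightarrow> 'i set) \<Rightarrow> nat \<Rightarrow> 'i \<Rightarrow> 'i list set" where
  "walks nb 0 i = {[i]}"
| "walks nb (Suc n) i = (\<Union>j\<in>nb i. Cons i ` walks nb n j)"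

lemma walks_bounds:
  assumes "\<And>i. i \<in> I \<Longrightarrow> nb i \<subseteq> I" "\<And>i. i \<in> I \<Longrightarrow> finite (nb i)" "\<And>i. i \<in> I \<Longrightarrow> card (nb i) \<le> D"
    and "i \<in> I"
  shows "finite (walks nb n i)" "card (walks nb n i) \<le> D ^ n"
    "\<And>p. p \<in> walks nb n i \<Longrightarrow> length p = Suc n \<and> set p \<subseteq> I"
proof -
  have "finite (walks nb n i) \<and> card (walks nb n i) \<le> D ^ n \<and>
      (\<forall>p\<in>walks nb n i. length p = Suc n \<and> set p \<subseteq> I)"
    using \<open>i \<in> I\<close>
  proof (induction n arbitrary: i)
    case (Suc n)
    have nb: "finite (walks nb n j)" "card (walks nb n j) \<le> D ^ n"
      "\<forall>p\<in>walks nb n j. length p = Suc n \<and> set p \<subseteq> I" if "j \<in> nb i" for j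
      using Suc assms(1) that by blast+
    have "card (walks nb (Suc n) i) \<le> (\<Sum>j\<in>nb i. card (Cons i ` walks nb n j))"
      unfolding walks.simps by (rule card_UN_le) (rule assms(2)[OF Suc.prems])
    also have "\<dots> \<le> (\<Sum>j\<in>nb i. D ^ n)"
      using nb by (intro sum_mono order_trans[OF card_image_le]) auto
    also have "\<dots> \<le> D ^ Suc n" using assms(3)[OF Suc.prems] by simp
    finally show ?case using nb Suc.prems assms(2)[OF Suc.prems] by auto
  qed simp
  then show "finite (walks nb n i)" "card (walks nb n i) \<le> D ^ n"
    "\<And>p. p \<in> walks nb n i \<Longrightarrow> length p = Suc n \<and> set p \<subseteq> I" by auto
qed

lemma map_upt_in_walks:
  assumes "\<And>m. f (Suc m) \<in> nb (f m)"
  shows "map f [k..<k + Suc n] \<in> walks nb n (f k)"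
proof (induction n arbitrary: k)
  case (Suc n)
  have "map f [k..<k + Suc (Suc n)] = f k # map f [Suc k..<Suc k + Suc n]"
    by (subst upt_conv_Cons) auto
  moreover have "f k # map f [Suc k..<Suc k + Suc n] \<in> walks nb (Suc n) (f k)"
    unfolding walks.simps by (rule UN_I[OF assms], rule imageI, rule Suc.IH)
  ultimately show ?case by (simp only:)
qed simp

text \<open>Divide the unit interval into \<open>D + 1\<close> bins. Along an infinite path of neighbours with decreasing times
  the times eventually stay in one bin. But there are at most \<open>D ^ n\<close> walks with \<open>n\<close> steps from a given
  item, and a self-avoiding one has all its times in a given bin with probability at most
  \<open>(1 / (D + 1)) ^ n\<close>. Since \<open>(D / (D + 1)) ^ n\<close> tends to \<open>0\<close>, almost surely no item starts arbitrarily long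
  self-avoiding walks inside one bin.\<close>

lemma AE_no_infinite_descent:
  fixes \<tau> :: "'i \<Rightarrow> 'm \<Rightarrow> real"
  assumes "prob_space M"
    and indep: "prob_space.indep_vars M (\<lambda>_. borel) \<tau> I"
    and unif: "\<And>i. i \<in> I \<Longrightarrow> distr M borel (\<tau> i) = uniform_measure lborel {0<..<1}"
    and "countable I"
    and nb: "\<And>i. i \<in> I \<Longrightarrow> nb i \<subseteq> I" "\<And>i. i \<in> I \<Longrightarrow> finite (nb i)" "\<And>i. i \<in> I \<Longrightarrow> card (nb i) \<le> D"
  shows "AE \<omega> in M. wf {(j, i). i \<in> I \<and> j \<in> nb i \<and> \<tau> j \<omega> < \<tau> i \<omega>}"
proof -
  interpret prob_space M by fact
  have rv [measurable]: "\<tau> i \<in> borel_measurable M" if "i \<in> I" for i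
    using indep that by (auto simp: indep_vars_def)
  have law: "prob (\<tau> i -` B \<inter> space M) = measure lborel ({0<..<1} \<inter> B)"
    if "i \<in> I" "B \<in> sets borel" for i B
  proof -
    have "prob (\<tau> i -` B \<inter> space M) = measure (distr M borel (\<tau> i)) B"
      using that by (simp add: measure_distr)
    also have "\<dots> = measure lborel ({0<..<1} \<inter> B)"
      using that(2) by (simp add: unif[OF that(1)] measure_uniform_measure)
    finally show ?thesis .
  qed
  \<comment> \<open>The number of bins; it exceeds \<open>D\<close>, so that the expected number of self-avoiding walks inside one bin decays with their length.\<close>
  define K where "K = Suc D"
  define bin where "bin m = {real m / K .. real (Suc m) / K}" for m :: nat
  have bin: "prob (\<tau> i -` bin m \<inter> space M) \<le> 1 / K" if "i \<in> I" for i m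
  proof -
    have "prob (\<tau> i -` bin m \<inter> space M) = measure lborel ({0<..<1} \<inter> bin m)"
      by (rule law[OF that]) (simp add: bin_def)
    also have "\<dots> \<le> measure lborel (bin m)"
      by (rule measure_mono_fmeasurable) (auto simp: bin_def fmeasurable_def emeasure_lborel_Icc_eq)
    also have "\<dots> = 1 / K" by (simp add: bin_def K_def field_simps)
    finally show ?thesis .
  qed
  define stuck where "stuck i m n = (\<Union>p\<in>{p\<in>walks nb n i. distinct p}.
      \<Inter>j\<in>set p. \<tau> j -` bin m \<inter> space M)" for i m n
  have walks: "finite (walks nb n i)" "card (walks nb n i) \<le> D ^ n"
    "p \<in> walks nb n i \<Longrightarrow> length p = Suc n \<and> set p \<subseteq> I" if "i \<in> I" for n i p
    using walks_bounds[where I=I and nb=nb and D=D and i=i and n=n] nb that by blast+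
  have stuck_event: "(\<Inter>j\<in>set p. \<tau> j -` bin m \<inter> space M) \<in> events"
    if "i \<in> I" "p \<in> walks nb n i" for i m n p
  proof (intro sets.finite_INT)
    show "set p \<noteq> {}" using walks(3)[OF that] by auto
    show "\<tau> j -` bin m \<inter> space M \<in> events" if "j \<in> set p" for j
      using walks(3)[OF \<open>i \<in> I\<close> \<open>p \<in> walks nb n i\<close>] that
      by (intro measurable_sets[OF rv]) (auto simp: bin_def)
  qed simp
  have [measurable]: "stuck i m n \<in> events" if "i \<in> I" for i m n
    unfolding stuck_def using that walks(1)[OF that] by (intro sets.finite_UN stuck_event) auto
  have stuck_le: "prob (stuck i m n) \<le> (D / K) ^ n" if "i \<in> I" for i m n
  proof -
    have walk: "prob (\<Inter>j\<in>set p. \<tau> j -` bin m \<inter> space M) \<le> (1 / K) ^ n"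
      if p: "p \<in> walks nb n i" "distinct p" for p
    proof -
      have len: "length p = Suc n" "set p \<subseteq> I" using walks(3)[OF \<open>i \<in> I\<close> p(1)] by auto
      have "prob (\<Inter>j\<in>set p. \<tau> j -` bin m \<inter> space M) = (\<Prod>j\<in>set p. prob (\<tau> j -` bin m \<inter> space M))"
        using len by (intro indep_varsD[OF indep]) (auto simp: bin_def)
      also have "\<dots> \<le> (\<Prod>j\<in>set p. 1 / K)"
        using len(2) bin by (intro prod_mono) auto
      also have "\<dots> = (1 / K) ^ Suc n" using len p(2) by (simp add: distinct_card)
      also have "\<dots> \<le> (1 / K) ^ n" by (intro power_decreasing) (auto simp: K_def)
      finally show ?thesis .
    qed
    let ?P = "{p\<in>walks nb n i. distinct p}"
    have fin: "finite ?P" using walks(1)[OF that] by simp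
    have cardP: "card ?P \<le> D ^ n"
      by (rule order_trans[OF card_mono walks(2)[OF that]]) (auto intro: walks(1)[OF that])
    have "prob (stuck i m n) \<le> (\<Sum>p\<in>?P. prob (\<Inter>j\<in>set p. \<tau> j -` bin m \<inter> space M))"
      unfolding stuck_def using that by (intro measure_UNION_le fin stuck_event) auto
    also have "\<dots> \<le> (\<Sum>p\<in>?P. (1 / K) ^ n)" using walk by (intro sum_mono) auto
    also have "\<dots> = card ?P * (1 / K) ^ n" by simp
    also have "\<dots> \<le> real (D ^ n) * (1 / K) ^ n"
      using cardP by (intro mult_right_mono of_nat_mono) auto
    also have "\<dots> = (D / K) ^ n" by (simp add: power_divide)
    finally show ?thesis by simp
  qed
  have "AE \<omega> in M. \<exists>n. \<omega> \<notin> stuck i m n" if "i \<in> I" for i m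
  proof (rule AE_I)
    show N: "(\<Inter>n. stuck i m n) \<in> events" using that by auto
    have "(\<lambda>n. (real D / K) ^ n) \<longlonglongrightarrow> 0" by (intro LIMSEQ_power_zero) (simp add: K_def)
    moreover have "prob (\<Inter>n. stuck i m n) \<le> (D / K) ^ n" for n
      using that by (intro order_trans[OF _ stuck_le[OF that, of m n]] finite_measure_mono) auto
    ultimately have "prob (\<Inter>n. stuck i m n) \<le> 0" by (intro LIMSEQ_le_const) auto
    then show "emeasure M (\<Inter>n. stuck i m n) = 0"
      by (simp add: emeasure_eq_measure measure_le_0_iff)
  qed auto
  then have "AE \<omega> in M. \<forall>i\<in>I. \<forall>m. \<exists>n. \<omega> \<notin> stuck i m n"
    using \<open>countable I\<close> by (simp add: AE_ball_countable AE_all_countable)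
  moreover have "AE \<omega> in M. \<forall>i\<in>I. \<tau> i \<omega> \<in> {0<..<1}"
  proof -
    have "AE \<omega> in M. \<omega> \<in> \<tau> i -` {0<..<1} \<inter> space M" if "i \<in> I" for i
      by (intro AE_in_set_eq_1[THEN iffD2] measurable_sets[OF rv[OF that]]) (simp_all add: law that)
    then have "AE \<omega> in M. \<tau> i \<omega> \<in> {0<..<1}" if "i \<in> I" for i
      using that by fastforce
    then show ?thesis using \<open>countable I\<close> by (simp add: AE_ball_countable)
  qed
  ultimately show ?thesis
    using AE_space
  proof eventually_elim
    case (elim \<omega>)
    show ?case
      unfolding wf_iff_no_infinite_down_chain
    proof
      assume "\<exists>f. \<forall>n. (f (Suc n), f n) \<in> {(j, i). i \<in> I \<and> j \<in> nb i \<and> \<tau> j \<omega> < \<tau> i \<omega>}"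
      then obtain f where f: "f n \<in> I" "f (Suc n) \<in> nb (f n)" "\<tau> (f (Suc n)) \<omega> < \<tau> (f n) \<omega>" for n
        by auto
      have dec: "\<tau> (f n) \<omega> < \<tau> (f m) \<omega>" if "m < n" for m n
        using lift_Suc_mono_less[of "\<lambda>n. - \<tau> (f n) \<omega>" m n] f(3) that by simp
      have pos: "0 < \<tau> (f n) \<omega>" for n using elim(2) f(1) by simp
      \<comment> \<open>Along the descending path the bin number \<open>b\<close> never increases, so it is constant once it is minimal.\<close>
      define b where "b n = nat \<lfloor>K * \<tau> (f n) \<omega>\<rfloor>" for n
      obtain N where N: "\<And>n. b N \<le> b n"
        using ex_has_least_nat[of "\<lambda>_. True" _ b] by auto
      have b_const: "b n = b N" if "N \<le> n" for n
      proof (rule antisym[OF _ N])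
        have "\<tau> (f n) \<omega> \<le> \<tau> (f N) \<omega>" using dec[of N n] that by (cases "n = N") auto
        then show "b n \<le> b N" unfolding b_def by (intro nat_mono floor_mono mult_left_mono) auto
      qed
      have in_bin: "\<tau> (f n) \<omega> \<in> bin (b N)" if "N \<le> n" for n
      proof -
        have "real (b n) \<le> K * \<tau> (f n) \<omega>" "K * \<tau> (f n) \<omega> \<le> real (Suc (b n))"
          using pos[of n] unfolding b_def by (auto simp: K_def intro: less_imp_le) linarith+
        then show ?thesis
          unfolding bin_def b_const[OF that, symmetric] by (auto simp: K_def field_simps)
      qed
      obtain n where n: "\<omega> \<notin> stuck (f N) (b N) n" using elim(1) f(1) by blast
      let ?p = "map f [N..<N + Suc n]"
      have "inj f"
        by (rule injI) (metis dec less_irrefl linorder_neqE_nat)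
      then have "distinct ?p" using inj_on_subset[OF _ subset_UNIV] by (simp add: distinct_map del: upt_Suc)
      moreover have "?p \<in> walks nb n (f N)" by (rule map_upt_in_walks) (rule f(2))
      moreover have "\<omega> \<in> (\<Inter>j\<in>set ?p. \<tau> j -` bin (b N) \<inter> space M)"
        using in_bin elim(3) by (auto simp del: upt_Suc)
      ultimately show False using n unfolding stuck_def by blast
    qed
  qed
qed

section \<open>Limits along finite subsets\<close>

lemma countable_finite_exhaustion:
  assumes "countable U"
  obtains F :: "nat \<Rightarrow> 'a set" where "\<And>n. finite (F n)" "incseq F" "(\<Union>n. F n) = U"
proof (cases "U = {}")
  case True
  then show ?thesis using that[of "\<lambda>_. {}"] by (simp add: incseq_def)
next
  case False
  then have "(\<Union>n. from_nat_into U ` {..<n}) = U"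
    using assms range_from_nat_into[of U] by (metis (no_types) UN_lessThan_UNIV image_UN)
  then show ?thesis by (intro that[of "\<lambda>n. from_nat_into U ` {..<n}"]) (auto simp: incseq_def)
qed

lemma filterlim_finite_approximation:
  assumes "finite_approximation S U"
  shows "filterlim S (finite_subsets_at_top U) sequentially"
  unfolding filterlim_finite_subsets_at_top
proof (intro allI impI)
  fix X assume X: "finite X \<and> X \<subseteq> U"
  have "\<forall>\<^sub>F n in sequentially. x \<in> S n" if "x \<in> U" for x
  proof -
    have "x \<in> (\<Union>n. \<Inter>m\<in>{n..}. S m)"
      using that assms by (simp add: finite_approximation_def)
    then obtain n where "\<And>m. n \<le> m \<Longrightarrow> x \<in> S m" by auto
    then show ?thesis unfolding eventually_sequentially by blast
  qed
  then have "\<forall>\<^sub>F n in sequentially. \<forall>x\<in>X. x \<in> S n"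
    using X by (auto simp: eventually_ball_finite_distrib)
  then show "\<forall>\<^sub>F n in sequentially. finite (S n) \<and> X \<subseteq> S n \<and> S n \<subseteq> U"
    by eventually_elim (use assms in \<open>auto simp: finite_approximation_def\<close>)
qed

lemma finite_approximation_sandwich:
  assumes F: "\<And>n. finite (F n)" "incseq F" "(\<Union>n. F n) = U"
    and S: "\<And>n. F n \<subseteq> S n" "\<And>n. finite (S n)" "\<And>n. S n \<subseteq> U"
  shows "finite_approximation S U"
  unfolding finite_approximation_def
proof (intro conjI allI subset_antisym subsetI)
  fix x assume "x \<in> U"
  then obtain n where "x \<in> F n" using F(3) by blast
  then have "x \<in> S m" if "n \<le> m" for m using incseqD[OF F(2) that] S(1)[of m] by blast
  then show "x \<in> (\<Union>n. \<Inter>m\<in>{n..}. S m)" by blast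
next
  fix x assume "x \<in> (\<Union>n. \<Inter>m\<in>{n..}. S m)"
  then obtain n where "x \<in> S n" by auto
  then show "x \<in> U" using S(3) by blast
qed (use S in blast)+

text \<open>If the values are not eventually \<open>x\<close> along the directed set of finite subsets, then beyond
  each member of an exhaustion of \<open>U\<close> there is a finite set with a different value, and these
  sets form an approximation that does not converge to \<open>x\<close>.\<close>

lemma limit_along_all_approximations_iff:
  fixes X :: "'a set \<Rightarrow> nat"
  assumes "countable U"
  shows "(\<forall>S. finite_approximation S U \<longrightarrow> (\<lambda>n. X (S n)) \<longlonglongrightarrow> x) \<longleftrightarrow>
    (\<forall>\<^sub>F F in finite_subsets_at_top U. X F = x)"
proof
  assume ev: "\<forall>\<^sub>F F in finite_subsets_at_top U. X F = x"
  show "\<forall>S. finite_approximation S U \<longrightarrow> (\<lambda>n. X (S n)) \<longlonglongrightarrow> x"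
    by (intro allI impI tendsto_eventually
        eventually_compose_filterlim[OF ev filterlim_finite_approximation])
next
  assume lim: "\<forall>S. finite_approximation S U \<longrightarrow> (\<lambda>n. X (S n)) \<longlonglongrightarrow> x"
  show "\<forall>\<^sub>F F in finite_subsets_at_top U. X F = x"
  proof (rule ccontr)
    assume "\<not> ?thesis"
    then have "\<forall>F. finite F \<and> F \<subseteq> U \<longrightarrow> (\<exists>G. finite G \<and> F \<subseteq> G \<and> G \<subseteq> U \<and> X G \<noteq> x)"
      by (auto simp: eventually_finite_subsets_at_top)
    then obtain g where g: "\<And>F. finite F \<Longrightarrow> F \<subseteq> U \<Longrightarrow>
        finite (g F) \<and> F \<subseteq> g F \<and> g F \<subseteq> U \<and> X (g F) \<noteq> x"
      by metis
    obtain F where F: "\<And>n. finite (F n)" "incseq F" "(\<Union>n. F n) = U"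
      using countable_finite_exhaustion[OF assms] by metis
    have gF: "finite (g (F n)) \<and> F n \<subseteq> g (F n) \<and> g (F n) \<subseteq> U \<and> X (g (F n)) \<noteq> x" for n
      using F by (intro g) auto
    then have "finite_approximation (\<lambda>n. g (F n)) U"
      by (intro finite_approximation_sandwich[OF F]) auto
    then have "(\<lambda>n. X (g (F n))) \<longlonglongrightarrow> x" using lim by blast
    then show False using gF by (simp add: tendsto_discrete)
  qed
qed

lemma extend_process_eqI:
  assumes "countable U" and ev: "\<forall>\<^sub>F F in finite_subsets_at_top U. X F t v = x"
  shows "extend_process X U t v = x"
proof (cases "finite U")
  case True
  then show ?thesis using ev
    by (simp add: extend_process_def eventually_finite_subsets_at_top_finite)
next
  case False
  have "y = x" if "\<forall>\<^sub>F F in finite_subsets_at_top U. X F t v = y" for y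
    using eventually_happens[OF eventually_conj[OF ev that]] by auto
  then have "(THE y. \<forall>\<^sub>F F in finite_subsets_at_top U. X F t v = y) = x"
    by (intro the_equality ev)
  then show ?thesis using False
    by (simp add: extend_process_def limit_along_all_approximations_iff[OF assms(1), of "\<lambda>F. X F t v"])
qed

text \<open>The default value is the same for all processes, which keeps the event that it is taken measurable.\<close>

lemma extend_process_no_limit:
  assumes "countable U" "infinite U" "\<nexists>x. \<forall>\<^sub>F F in finite_subsets_at_top U. X F t v = x"
  shows "extend_process X U t v = (THE x. False)"
proof -
  have none: "(\<lambda>x. \<forall>S. finite_approximation S U \<longrightarrow> (\<lambda>n. X (S n) t v) \<longlonglongrightarrow> x) = (\<lambda>_. False)"
    using assms(3)
    by (simp only: fun_eq_iff limit_along_all_approximations_iff[OF assms(1), of "\<lambda>F. X F t v"]) blast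
  show ?thesis by (simp only: extend_process_def none if_not_P[OF assms(2)])
qed

text \<open>A countable set has only countably many finite subsets, so ``eventually constant along finite
  subsets'' is a countable combination of events of finite processes.\<close>

lemma measurable_extend_process:
  assumes "countable U"
    and meas: "\<And>F y. finite F \<Longrightarrow> F \<subseteq> U \<Longrightarrow> Measurable.pred M (\<lambda>\<omega>. X \<omega> F t v = y)"
  shows "Measurable.pred M (\<lambda>\<omega>. extend_process (X \<omega>) U t v = x)"
proof (cases "finite U")
  case True
  then show ?thesis using meas by (simp add: extend_process_def)
next
  case False
  let ?Fin = "{F. F \<subseteq> U \<and> finite F}"
  define lim where "lim y \<omega> \<longleftrightarrow> (\<exists>F\<in>?Fin. \<forall>G\<in>?Fin. F \<subseteq> G \<longrightarrow> X \<omega> G t v = y)" for y \<omega>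
  have lim_iff: "lim y \<omega> \<longleftrightarrow> (\<forall>\<^sub>F F in finite_subsets_at_top U. X \<omega> F t v = y)" for y \<omega>
    unfolding lim_def eventually_finite_subsets_at_top by blast
  have cnt: "countable ?Fin"
    using countable_Collect_finite_subset[OF assms(1)] by (simp add: conj_commute)
  have [measurable]: "Measurable.pred M (lim y)" for y
    unfolding lim_def pred_def
  proof (intro sets.sets_Collect_countable_Ex'[OF _ cnt] sets.sets_Collect_countable_All'[OF _ cnt])
    fix F G assume "G \<in> ?Fin"
    then have [measurable]: "Measurable.pred M (\<lambda>\<omega>. X \<omega> G t v = y)" using meas by blast
    show "{\<omega> \<in> space M. F \<subseteq> G \<longrightarrow> X \<omega> G t v = y} \<in> sets M" by measurable
  qed
  have "extend_process (X \<omega>) U t v = x \<longleftrightarrow> lim x \<omega> \<or> (\<not> (\<exists>y. lim y \<omega>) \<and> x = (THE x. False))" for \<omega>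
  proof (cases "\<exists>y. lim y \<omega>")
    case True
    then obtain y where y: "lim y \<omega>" by blast
    have eq: "extend_process (X \<omega>) U t v = z" if "lim z \<omega>" for z
      using extend_process_eqI[OF assms(1)] that lim_iff by blast
    show ?thesis using eq[OF y] y eq True by blast
  next
    case no_limit: False
    then have "extend_process (X \<omega>) U t v = (THE x. False)"
      by (intro extend_process_no_limit assms(1) False) (simp add: lim_iff)
    then show ?thesis using no_limit by auto
  qed
  then show ?thesis by simp
qed

lemma eventually_finite_subsets:
  "\<forall>\<^sub>F F in finite_subsets_at_top U. finite F \<and> F \<subseteq> U"
  by (rule eventually_finite_subsets_at_top_weakI) simp

lemma eventually_subset_finite_subsets:
  assumes "finite X" "X \<subseteq> U"
  shows "\<forall>\<^sub>F F in finite_subsets_at_top U. X \<subseteq> F"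
  using assms unfolding eventually_finite_subsets_at_top by blast

section \<open>Graphs: parity and degrees\<close>

lemma bipartite_colouring:
  assumes "simple_graph V E" "bipartite V E"
  obtains A where "\<And>x y. {x, y} \<in> E \<Longrightarrow> x \<in> A \<longleftrightarrow> y \<notin> A"
proof -
  obtain A B where AB: "A \<union> B = V" "A \<inter> B = {}" "independent_set E A" "independent_set E B"
    using assms(2) unfolding bipartite_def by blast
  have "x \<in> A \<longleftrightarrow> y \<notin> A" if e: "{x, y} \<in> E" for x y
  proof -
    have "\<not> {x, y} \<subseteq> A" "\<not> {x, y} \<subseteq> B"
      using AB(3,4) e by (auto simp: independent_set_def induced_edges_def)
    moreover have "{x, y} \<subseteq> V" using assms(1) e by (auto simp: simple_graph_def)
    ultimately show ?thesis using AB(1) by blast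
  qed
  then show ?thesis by (rule that)
qed

lemma parity_state_eq:
  assumes col: "\<And>x y. {x, y} \<in> E \<Longrightarrow> x \<in> A \<longleftrightarrow> y \<notin> A" and "finite_dist E v v\<^sub>0"
  shows "parity_state E v\<^sub>0 v = (if v \<in> A \<longleftrightarrow> v\<^sub>0 \<in> A then 0 else 1)"
proof -
  have walk: "even n \<longleftrightarrow> (v \<in> A \<longleftrightarrow> w \<in> A)" if "(v, w) \<in> adjacency E ^^ n" for n w
    using that
  proof (induction n arbitrary: w)
    case (Suc n)
    then obtain u where "(v, u) \<in> adjacency E ^^ n" "{u, w} \<in> E" by (auto simp: adjacency_def)
    then show ?case using Suc.IH col by auto
  qed simp
  obtain n where "(v, v\<^sub>0) \<in> adjacency E ^^ n"
    using assms(2) by (auto simp: finite_dist_def rtrancl_power)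
  then have "(v, v\<^sub>0) \<in> adjacency E ^^ graph_dist E v v\<^sub>0"
    unfolding graph_dist_def by (rule LeastI)
  then show ?thesis using walk by (simp add: parity_state_def)
qed

lemma bounded_degree_if_finite:
  assumes "finite V" "simple_graph V E"
  shows "bounded_degree V E"
proof -
  have "finite E" using assms by (intro finite_subset[of E "Pow V"]) (auto simp: simple_graph_def)
  then show ?thesis unfolding bounded_degree_def
    by (intro exI[of _ "card E"]) (auto intro: card_mono)
qed

lemma finite_induced_edges:
  assumes "finite U"
  shows "finite (induced_edges E U)"
  by (rule finite_subset[of _ "Pow U"]) (use assms in \<open>auto simp: induced_edges_def\<close>)

lemma bounded_degree_edges_at:
  assumes "simple_graph V E" "bounded_degree V E"
  obtains d where "\<And>x. finite {e\<in>E. x \<in> e}" "\<And>x. card {e\<in>E. x \<in> e} \<le> d"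
proof -
  obtain d where d: "\<And>x. x \<in> V \<Longrightarrow> finite {e\<in>E. x \<in> e} \<and> card {e\<in>E. x \<in> e} \<le> d"
    using assms(2) by (auto simp: bounded_degree_def)
  have "finite {e\<in>E. x \<in> e} \<and> card {e\<in>E. x \<in> e} \<le> d" for x
  proof (cases "x \<in> V")
    case False
    then have none: "{e\<in>E. x \<in> e} = {}" using assms(1) by (auto simp: simple_graph_def)
    show ?thesis unfolding none by simp
  qed (rule d)
  then show ?thesis by (intro that[of d]) auto
qed

lemma neighbours_bounds:
  assumes "finite {e\<in>E. v \<in> e}"
  shows "finite {u\<in>V. {u, v} \<in> E}" "card {u\<in>V. {u, v} \<in> E} \<le> card {e\<in>E. v \<in> e}"
proof -
  have inj: "inj_on (\<lambda>u. {u, v}) {u\<in>V. {u, v} \<in> E}" by (auto simp: inj_on_def doubleton_eq_iff)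
  have img: "(\<lambda>u. {u, v}) ` {u\<in>V. {u, v} \<in> E} \<subseteq> {e\<in>E. v \<in> e}" by auto
  show "finite {u\<in>V. {u, v} \<in> E}" by (rule inj_on_finite[OF inj img assms])
  show "card {u\<in>V. {u, v} \<in> E} \<le> card {e\<in>E. v \<in> e}" by (rule card_inj_on_le[OF inj img assms])
qed

section \<open>From finite graphs to infinite ones\<close>

text \<open>The common end of both proofs. The process \<open>X\<close> on a finite set \<open>U\<close> is a function of the independent
  inputs \<open>Y i\<close> with \<open>i\<close> in \<open>C U\<close>, which are the sites or the induced edges of \<open>U\<close>; \<open>le\<close> orders the values
  of each input so that being in state \<open>s v\<close> at \<open>v\<close> is an increasing event. Exhaust \<open>V\<close> by finite sets
  \<open>F n\<close>, apply the Harris inequality to the processes on \<open>W j \<inter> F n\<close>, and let \<open>n\<close> tend to infinity.\<close>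

lemma positive_association_limit:
  fixes X :: "('i \<Rightarrow> 'b) \<Rightarrow> 'a set \<Rightarrow> real \<Rightarrow> 'a \<Rightarrow> nat" and Y :: "'i \<Rightarrow> 'm \<Rightarrow> 'b"
  assumes "prob_space M" and indep: "prob_space.indep_vars M N Y I" and "countable V"
    and total: "\<And>i x y. i \<in> I \<Longrightarrow> x \<in> space (N i) \<Longrightarrow> y \<in> space (N i) \<Longrightarrow> le i x y \<or> le i y x"
    and C: "\<And>U. finite U \<Longrightarrow> U \<subseteq> V \<Longrightarrow> finite (C U) \<and> C U \<subseteq> I" "\<And>U F. U \<subseteq> F \<Longrightarrow> C U \<subseteq> C F"
    and local: "\<And>p q U. \<forall>i\<in>C U. p i = q i \<Longrightarrow> X p U = X q U"
    and meas: "\<And>U F t v x. finite F \<Longrightarrow> F \<subseteq> V \<Longrightarrow> U \<subseteq> F \<Longrightarrow>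
      Measurable.pred (PiM (C F) N) (\<lambda>p. X p U t v = x)"
    and increasing: "\<And>U F t v p q. finite F \<Longrightarrow> F \<subseteq> V \<Longrightarrow> U \<subseteq> F \<Longrightarrow>
      p \<in> space (PiM (C F) N) \<Longrightarrow> q \<in> space (PiM (C F) N) \<Longrightarrow> \<forall>i\<in>C F. le i (p i) (q i) \<Longrightarrow>
      X p U t v = s v \<Longrightarrow> X q U t v = s v"
    and converge: "AE \<omega> in M. \<forall>U\<subseteq>V. \<forall>t v. \<exists>x.
      \<forall>\<^sub>F F in finite_subsets_at_top U. X (\<lambda>i. Y i \<omega>) F t v = x"
    and J: "finite J\<^sub>1" "finite J\<^sub>2" and W: "\<And>j. j \<in> J\<^sub>1 \<union> J\<^sub>2 \<Longrightarrow> W j \<subseteq> V"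
  shows "\<P>(\<omega> in M. \<forall>j\<in>J\<^sub>1. extend_process (X (\<lambda>i. Y i \<omega>)) (W j) (t j) (v j) = s (v j))
      * \<P>(\<omega> in M. \<forall>j\<in>J\<^sub>2. extend_process (X (\<lambda>i. Y i \<omega>)) (W j) (t j) (v j) = s (v j))
    \<le> \<P>(\<omega> in M. \<forall>j\<in>J\<^sub>1 \<union> J\<^sub>2. extend_process (X (\<lambda>i. Y i \<omega>)) (W j) (t j) (v j) = s (v j))"
proof -
  interpret prob_space M by fact
  obtain F where F: "\<And>n. finite (F n)" "incseq F" "(\<Union>n. F n) = V"
    using countable_finite_exhaustion[OF \<open>countable V\<close>] by metis
  have FV: "F n \<subseteq> V" for n using F(3) by blast
  define A where "A n J p \<longleftrightarrow> (\<forall>j\<in>J. X p (W j \<inter> F n) (t j) (v j) = s (v j))" for n J p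
  define L where "L J \<omega> \<longleftrightarrow> (\<forall>j\<in>J. extend_process (X (\<lambda>i. Y i \<omega>)) (W j) (t j) (v j) = s (v j))" for J \<omega>
  let ?Z = "\<lambda>U \<omega>. \<lambda>i\<in>C U. Y i \<omega>"
  have rv: "random_variable (N i) (Y i)" if "i \<in> I" for i
    using indep that by (auto simp: indep_vars_def)
  have Z: "?Z U \<in> measurable M (PiM (C U) N)" if "finite U" "U \<subseteq> V" for U
    using C(1)[OF that] by (intro measurable_restrict rv) auto
  have X_Z: "X (\<lambda>i. Y i \<omega>) U = X (?Z U' \<omega>) U" if "U \<subseteq> U'" for U U' \<omega>
    using C(2)[OF that] by (intro local) auto
  have X_meas: "Measurable.pred M (\<lambda>\<omega>. X (\<lambda>i. Y i \<omega>) U t v = x)"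
    if "finite U" "U \<subseteq> V" for U t v x
    unfolding X_Z[OF subset_refl]
    by (rule measurable_compose[OF Z[OF that] meas[OF that subset_refl]])
  have A_Z: "A n J (\<lambda>i. Y i \<omega>) = A n J (?Z (F n) \<omega>)" for n J \<omega>
    unfolding A_def using X_Z[OF Int_lower2] by metis
  have A_meas: "Measurable.pred (PiM (C (F n)) N) (A n J)" if "finite J" for n J
    unfolding A_def using that by (intro pred_intros_finite meas F(1) FV) auto
  have A_meas': "Measurable.pred M (\<lambda>\<omega>. A n J (\<lambda>i. Y i \<omega>))" if "finite J" for n J
    unfolding A_Z by (rule measurable_compose[OF Z[OF F(1) FV] A_meas[OF that]])
  have L_meas: "Measurable.pred M (L J)" if "finite J" "J \<subseteq> J\<^sub>1 \<union> J\<^sub>2" for J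
    unfolding L_def
  proof (rule pred_intros_finite(3)[OF that(1)])
    fix j assume "j \<in> J"
    then have "W j \<subseteq> V" using W that(2) by blast
    then show "Measurable.pred M (\<lambda>\<omega>. extend_process (X (\<lambda>i. Y i \<omega>)) (W j) (t j) (v j) = s (v j))"
      using \<open>countable V\<close> by (intro measurable_extend_process X_meas) (auto intro: countable_subset)
  qed
  have A_L: "AE \<omega> in M. \<forall>\<^sub>F n in sequentially. A n J (\<lambda>i. Y i \<omega>) \<longleftrightarrow> L J \<omega>"
    if J: "finite J" "J \<subseteq> J\<^sub>1 \<union> J\<^sub>2" for J
    using converge
  proof eventually_elim
    case (elim \<omega>)
    have "\<forall>\<^sub>F n in sequentially. X (\<lambda>i. Y i \<omega>) (W j \<inter> F n) (t j) (v j)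
        = extend_process (X (\<lambda>i. Y i \<omega>)) (W j) (t j) (v j)" if "j \<in> J" for j
    proof -
      have Wj: "W j \<subseteq> V" using W J that by blast
      then obtain x where x: "\<forall>\<^sub>F F in finite_subsets_at_top (W j). X (\<lambda>i. Y i \<omega>) F (t j) (v j) = x"
        using elim by blast
      have "extend_process (X (\<lambda>i. Y i \<omega>)) (W j) (t j) (v j) = x"
        using \<open>countable V\<close> Wj by (intro extend_process_eqI x) (rule countable_subset)
      moreover have "finite_approximation (\<lambda>n. W j \<inter> F n) (W j)"
      proof (rule finite_approximation_sandwich)
        show "incseq (\<lambda>n. W j \<inter> F n)" using F(2) by (auto simp: incseq_def)
        show "(\<Union>n. W j \<inter> F n) = W j" using F(3) Wj by blast
      qed (use F(1) in auto)
      ultimately show ?thesis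
        using eventually_compose_filterlim[OF x filterlim_finite_approximation] by simp
    qed
    then have "\<forall>\<^sub>F n in sequentially. \<forall>j\<in>J. X (\<lambda>i. Y i \<omega>) (W j \<inter> F n) (t j) (v j)
        = extend_process (X (\<lambda>i. Y i \<omega>)) (W j) (t j) (v j)"
      using J(1) by (simp add: eventually_ball_finite_distrib)
    then show ?case by eventually_elim (simp add: A_def L_def)
  qed
  have tendsto: "(\<lambda>n. \<P>(\<omega> in M. A n J (\<lambda>i. Y i \<omega>))) \<longlonglongrightarrow> \<P>(\<omega> in M. L J \<omega>)"
    if "finite J" "J \<subseteq> J\<^sub>1 \<union> J\<^sub>2" for J
    by (intro prob_tendsto_AE A_meas' L_meas A_L that)
  have up: "A n J q" if "p \<in> space (PiM (C (F n)) N)" "q \<in> space (PiM (C (F n)) N)"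
    "\<forall>i\<in>C (F n). le i (p i) (q i)" "A n J p" for n J p q
    using that(4) increasing[OF F(1) FV Int_lower2 that(1-3)] unfolding A_def by blast
  have finite_case: "\<P>(\<omega> in M. A n J\<^sub>1 (\<lambda>i. Y i \<omega>)) * \<P>(\<omega> in M. A n J\<^sub>2 (\<lambda>i. Y i \<omega>))
      \<le> \<P>(\<omega> in M. A n (J\<^sub>1 \<union> J\<^sub>2) (\<lambda>i. Y i \<omega>))" for n
  proof -
    have CF: "finite (C (F n))" "C (F n) \<subseteq> I" using C(1)[OF F(1) FV] by auto
    have "\<P>(\<omega> in M. A n J\<^sub>1 (?Z (F n) \<omega>)) * \<P>(\<omega> in M. A n J\<^sub>2 (?Z (F n) \<omega>))
        \<le> \<P>(\<omega> in M. A n J\<^sub>1 (?Z (F n) \<omega>) \<and> A n J\<^sub>2 (?Z (F n) \<omega>))"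
    proof (rule harris_indep_vars[where le=le, OF indep_vars_subset[OF indep CF(2)] CF(1)])
      show "le i x y \<or> le i y x" if "i \<in> C (F n)" "x \<in> space (N i)" "y \<in> space (N i)" for i x y
        using total that CF(2) by blast
    qed (rule A_meas[OF J(1)], rule A_meas[OF J(2)], rule up, assumption+, rule up, assumption+)
    also have "(\<lambda>\<omega>. A n J\<^sub>1 (?Z (F n) \<omega>) \<and> A n J\<^sub>2 (?Z (F n) \<omega>)) = (\<lambda>\<omega>. A n (J\<^sub>1 \<union> J\<^sub>2) (?Z (F n) \<omega>))"
      unfolding A_def by blast
    finally show ?thesis unfolding A_Z .
  qed
  have "\<P>(\<omega> in M. L J\<^sub>1 \<omega>) * \<P>(\<omega> in M. L J\<^sub>2 \<omega>) \<le> \<P>(\<omega> in M. L (J\<^sub>1 \<union> J\<^sub>2) \<omega>)"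
    by (rule LIMSEQ_le[OF tendsto_mult[OF tendsto tendsto] tendsto]) (use J finite_case in auto)
  then show ?thesis unfolding L_def .
qed

section \<open>Positive association for random sequential adsorption\<close>

lemma finite_rsa_cong:
  assumes "\<forall>v\<in>U. \<tau> v = \<tau>' v"
  shows "finite_rsa E \<tau> U = finite_rsa E \<tau>' U"
proof -
  have "rsa_update E U \<tau> = rsa_update E U \<tau>'"
    using assms by (auto simp: rsa_update_def fun_eq_iff)
  moreover have "\<tau> ` U = \<tau>' ` U" using assms by (intro image_cong) auto
  ultimately show ?thesis by (intro ext) (simp only: finite_rsa_def)
qed

text \<open>For adsorption a success at a site means that it is occupied, so favoured sites are those where state
  \<open>1\<close> is asked for. For annihilation it will be state \<open>0\<close>, since there a success vacates the site.\<close>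

lemma finite_rsa_mono:
  assumes "finite U"
    and alternate: "\<And>x y. {x, y} \<in> E \<Longrightarrow> favoured x \<longleftrightarrow> \<not> favoured y"
    and times: "\<And>x. x \<in> U \<Longrightarrow> if favoured x then \<tau>' x \<le> \<tau> x else \<tau> x \<le> \<tau>' x"
    and state: "finite_rsa E \<tau> U t v = (if favoured v then 1 else 0)"
  shows "finite_rsa E \<tau>' U t v = (if favoured v then 1 else 0)"
proof (cases "v \<in> U")
  case True
  have "if favoured v then rsa_accepts E \<tau> U v \<longrightarrow> rsa_accepts E \<tau>' U v
      else rsa_accepts E \<tau>' U v \<longrightarrow> rsa_accepts E \<tau> U v"
    using alternate times
    by (intro blocking_solution_mono[OF assms(1) rsa_blocking_solution[OF assms(1)]
          rsa_blocking_solution[OF assms(1)] _ _ _ True]) (auto split: if_splits)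
  then show ?thesis using state times[OF True] True
    by (auto simp: finite_rsa_eq[OF assms(1)] split: if_splits)
qed (use state in \<open>auto simp: finite_rsa_eq[OF assms(1)] split: if_splits\<close>)

lemma measurable_finite_rsa:
  assumes "finite U" and \<tau>: "\<And>x. x \<in> U \<Longrightarrow> (\<lambda>\<omega>. \<tau> \<omega> x) \<in> borel_measurable M"
  shows "Measurable.pred M (\<lambda>\<omega>. finite_rsa E (\<tau> \<omega>) U t v = y)"
proof (cases "v \<in> U")
  case True
  have [measurable]: "(\<lambda>\<omega>. \<tau> \<omega> v) \<in> borel_measurable M" by (rule \<tau>[OF True])
  have [measurable]: "Measurable.pred M (\<lambda>\<omega>. rsa_accepts E (\<tau> \<omega>) U v)"
    using \<tau> by (intro measurable_blocking_solution[OF assms(1) _ rsa_blocking_solution[OF assms(1)] True])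
      (auto intro: borel_measurable_ereal)
  show ?thesis unfolding finite_rsa_eq[OF assms(1)] by measurable
qed (simp add: finite_rsa_eq[OF assms(1)])

lemma finite_rsa_converges:
  assumes wf: "wf {(u, v). v \<in> V \<and> u \<in> {u\<in>V. {u, v} \<in> E} \<and> \<tau> u < \<tau> v}"
    and locally_finite: "\<And>v. finite {e\<in>E. v \<in> e}" and "U \<subseteq> V"
  shows "\<exists>x. \<forall>\<^sub>F F in finite_subsets_at_top U. finite_rsa E \<tau> F t v = x"
proof (cases "v \<in> U")
  case False
  have "\<forall>\<^sub>F F in finite_subsets_at_top U. finite_rsa E \<tau> F t v = 0"
    using eventually_finite_subsets by eventually_elim (use False in \<open>auto simp: finite_rsa_eq\<close>)
  then show ?thesis by blast
next
  case True
  have "\<exists>b. \<forall>\<^sub>F F in finite_subsets_at_top U. rsa_accepts E \<tau> F v = b"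
  proof (rule blocking_solutions_converge[where R="\<lambda>u v. {u, v} \<in> E" and S=U and S'="\<lambda>F. F"
        and T="\<lambda>v. ereal (\<tau> v)"])
    show "wf {(i, j). j \<in> U \<and> i \<in> U \<and> {i, j} \<in> E \<and> ereal (\<tau> i) < ereal (\<tau> j) \<and> ereal (\<tau> j) < \<infinity>}"
      by (rule wf_subset[OF wf]) (use \<open>U \<subseteq> V\<close> in auto)
    show "finite {u\<in>U. {u, w} \<in> E}" for w by (rule neighbours_bounds(1)[OF locally_finite])
    show "\<forall>\<^sub>F F in finite_subsets_at_top U. blocking_solution (\<lambda>u v. {u, v} \<in> E) F (\<lambda>v. ereal (\<tau> v)) (rsa_accepts E \<tau> F)"
      using eventually_finite_subsets by eventually_elim (simp add: rsa_blocking_solution)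
    show "\<forall>\<^sub>F F in finite_subsets_at_top U. F \<subseteq> U"
      using eventually_finite_subsets by eventually_elim simp
    show "\<forall>\<^sub>F F in finite_subsets_at_top U. w \<in> F" if "w \<in> U" for w
      using eventually_subset_finite_subsets[of "{w}" U] that by simp
  qed (rule True)
  then obtain b where b: "\<forall>\<^sub>F F in finite_subsets_at_top U. rsa_accepts E \<tau> F v = b" by blast
  have "\<forall>\<^sub>F F in finite_subsets_at_top U. {v} \<subseteq> F"
    using True by (intro eventually_subset_finite_subsets) auto
  with b eventually_finite_subsets
  have "\<forall>\<^sub>F F in finite_subsets_at_top U. finite_rsa E \<tau> F t v = (if \<tau> v \<le> t \<and> b then 1 else 0)"
    by eventually_elim (auto simp: finite_rsa_eq)
  then show ?thesis by blast
qed

theorem rsa_positive_association: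
  fixes \<tau> :: "'a \<Rightarrow> 'm \<Rightarrow> real"
  assumes rnd: "rsa_randomness M V \<tau>" and "countable V" and graph: "simple_graph V E" "bounded_degree V E"
    and alternate: "\<And>x y. {x, y} \<in> E \<Longrightarrow> favoured x \<longleftrightarrow> \<not> favoured y"
    and J: "finite J\<^sub>1" "finite J\<^sub>2" "\<And>j. j \<in> J\<^sub>1 \<union> J\<^sub>2 \<Longrightarrow> W j \<subseteq> V"
  defines "s \<equiv> \<lambda>x. if favoured x then 1 else 0"
  shows "\<P>(\<omega> in M. \<forall>j\<in>J\<^sub>1. blocking_rsa E (\<lambda>x. \<tau> x \<omega>) (W j) (t j) (v j) = s (v j))
      * \<P>(\<omega> in M. \<forall>j\<in>J\<^sub>2. blocking_rsa E (\<lambda>x. \<tau> x \<omega>) (W j) (t j) (v j) = s (v j))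
    \<le> \<P>(\<omega> in M. \<forall>j\<in>J\<^sub>1 \<union> J\<^sub>2. blocking_rsa E (\<lambda>x. \<tau> x \<omega>) (W j) (t j) (v j) = s (v j))"
  unfolding blocking_rsa_def
proof (rule positive_association_limit[where X="finite_rsa E" and Y=\<tau> and I=V and C="\<lambda>U. U"
      and N="\<lambda>_. borel" and le="\<lambda>v x y. if favoured v then y \<le> x else x \<le> y"])
  have rnd': "prob_space M" "prob_space.indep_vars M (\<lambda>_. borel) \<tau> V"
    "\<And>v. v \<in> V \<Longrightarrow> distr M borel (\<tau> v) = uniform_measure lborel {0<..<1}"
    using rnd by (auto simp: rsa_randomness_def)
  then show "prob_space M" "prob_space.indep_vars M (\<lambda>_. borel) \<tau> V" by auto
  obtain d where d: "\<And>x. finite {e\<in>E. x \<in> e}" "\<And>x. card {e\<in>E. x \<in> e} \<le> d"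
    using bounded_degree_edges_at[OF graph] by metis
  have "AE \<omega> in M. wf {(u, v). v \<in> V \<and> u \<in> {u\<in>V. {u, v} \<in> E} \<and> \<tau> u \<omega> < \<tau> v \<omega>}"
  proof (rule AE_no_infinite_descent[OF rnd' \<open>countable V\<close>])
    show "finite {u\<in>V. {u, v} \<in> E}" for v by (rule neighbours_bounds(1)[OF d(1)])
    show "card {u\<in>V. {u, v} \<in> E} \<le> d" for v
      by (rule order_trans[OF neighbours_bounds(2)[OF d(1)] d(2)])
  qed auto
  then show "AE \<omega> in M. \<forall>U\<subseteq>V. \<forall>t v. \<exists>x.
      \<forall>\<^sub>F F in finite_subsets_at_top U. finite_rsa E (\<lambda>i. \<tau> i \<omega>) F t v = x"
    by eventually_elim (intro allI impI finite_rsa_converges[where V=V] d(1))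
  show "finite_rsa E q U t v = s v"
    if F: "finite F" "U \<subseteq> F" and pq: "\<forall>i\<in>F. if favoured i then q i \<le> p i else p i \<le> q i"
      and state: "finite_rsa E p U t v = s v" for U F t v p q
    unfolding s_def
  proof (rule finite_rsa_mono[where \<tau>=p, OF finite_subset[OF F(2,1)] alternate])
    show "if favoured x then q x \<le> p x else p x \<le> q x" if "x \<in> U" for x
      using pq F(2) that by blast
    show "finite_rsa E p U t v = (if favoured v then 1 else 0)" using state by (simp only: s_def)
  qed
  show "Measurable.pred (PiM F (\<lambda>_. borel)) (\<lambda>p. finite_rsa E p U t v = x)"
    if F: "finite F" "U \<subseteq> F" for U F t v x
    using F(2) by (intro measurable_finite_rsa[OF finite_subset[OF F(2,1)]] measurable_component_singleton) blast
  show "finite_rsa E p U = finite_rsa E q U" if "\<forall>i\<in>U. p i = q i" for p q :: "'a \<Rightarrow> real" and U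
    by (rule finite_rsa_cong[OF that])
qed (use \<open>countable V\<close> J in auto)

section \<open>Positive association for annihilation\<close>

lemma finite_annihilation_cong:
  assumes "\<forall>e\<in>induced_edges E U. \<sigma> e = \<sigma>' e \<and> \<alpha> e = \<alpha>' e"
  shows "finite_annihilation E \<sigma> \<alpha> U = finite_annihilation E \<sigma>' \<alpha>' U"
proof -
  have "annihilation_update E U \<sigma> \<alpha> = annihilation_update E U \<sigma>' \<alpha>'"
    using assms unfolding annihilation_update_def by (intro ext if_cong bex_cong refl) auto
  moreover have "\<sigma> ` induced_edges E U = \<sigma>' ` induced_edges E U" using assms by (intro image_cong) auto
  ultimately show ?thesis by (intro ext) (simp only: finite_annihilation_def)
qed

lemma card_2_other_endpoint:
  assumes "card e = 2" "x \<in> e" "y \<in> e" "x \<noteq> y"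
  shows "e = {x, y}"
  using assms by (auto simp: card_2_iff)

text \<open>Favoured sites are wanted vacant and the others occupied: advancing the attacks on favoured sites and
  delaying those on the others preserves this. Since \<open>x' \<in> e\<close> and \<open>x' \<noteq> x\<close> make \<open>x'\<close> the other endpoint of
  \<open>e\<close>, attacks on sites of one class are blocked by attacks on sites of the other class only.\<close>

lemma finite_annihilation_mono:
  assumes "finite U" and simple: "\<forall>e\<in>E. card e = 2"
    and alternate: "\<And>x y. {x, y} \<in> E \<Longrightarrow> favoured x \<longleftrightarrow> \<not> favoured y"
    and \<alpha>: "\<forall>e\<in>induced_edges E U. \<alpha> e \<in> e" "\<forall>e\<in>induced_edges E U. \<alpha>' e \<in> e"
    and times: "\<And>e x. e \<in> induced_edges E U \<Longrightarrow> x \<in> e \<Longrightarrow>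
      if favoured x then attack_time \<sigma>' \<alpha>' (e, x) \<le> attack_time \<sigma> \<alpha> (e, x)
      else attack_time \<sigma> \<alpha> (e, x) \<le> attack_time \<sigma>' \<alpha>' (e, x)"
    and state: "finite_annihilation E \<sigma> \<alpha> U t v = (if favoured v then 0 else 1)"
  shows "finite_annihilation E \<sigma>' \<alpha>' U t v = (if favoured v then 0 else 1)"
proof -
  let ?S = "directed_edges (induced_edges E U)"
  have fin: "finite (induced_edges E U)" by (rule finite_induced_edges) fact
  have finS: "finite ?S"
  proof (rule finite_subset)
    show "?S \<subseteq> induced_edges E U \<times> U" by (auto simp: directed_edges_def induced_edges_def)
  qed (use fin assms(1) in auto)
  have armed: "if favoured x then attack_armed E \<sigma> \<alpha> U (e, x) \<longrightarrow> attack_armed E \<sigma>' \<alpha>' U (e, x)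
      else attack_armed E \<sigma>' \<alpha>' U (e, x) \<longrightarrow> attack_armed E \<sigma> \<alpha> U (e, x)"
    if "e \<in> induced_edges E U" "x \<in> e" for e x
  proof -
    have "if (favoured \<circ> snd) (e, x) then attack_armed E \<sigma> \<alpha> U (e, x) \<longrightarrow> attack_armed E \<sigma>' \<alpha>' U (e, x)
      else attack_armed E \<sigma>' \<alpha>' U (e, x) \<longrightarrow> attack_armed E \<sigma> \<alpha> U (e, x)"
    proof (rule blocking_solution_mono[OF finS annihilation_blocking_solution[OF fin \<alpha>(1)]
          annihilation_blocking_solution[OF fin \<alpha>(2)]])
      show "(favoured \<circ> snd) j \<longleftrightarrow> \<not> (favoured \<circ> snd) i" if "i \<in> ?S" "j \<in> ?S" "attacks j i" for i j
      proof -
        obtain e x e' x' where ij: "i = (e, x)" "j = (e', x')" by fastforce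
        then have "e \<in> E" "x \<in> e" "x' \<in> e" "x' \<noteq> x"
          using that by (auto simp: directed_edges_def induced_edges_def attacks_def)
        then have "{x', x} \<in> E" using card_2_other_endpoint[of e x' x] simple by auto
        then show ?thesis using alternate ij by auto
      qed
      show "attack_time \<sigma>' \<alpha>' i \<le> attack_time \<sigma> \<alpha> i" if "i \<in> ?S" "(favoured \<circ> snd) i" for i
        using times[of "fst i" "snd i"] that by (auto simp: directed_edges_def)
      show "attack_time \<sigma> \<alpha> i \<le> attack_time \<sigma>' \<alpha>' i" if "i \<in> ?S" "\<not> (favoured \<circ> snd) i" for i
        using times[of "fst i" "snd i"] that by (auto simp: directed_edges_def)
    qed (use that in \<open>simp add: directed_edges_def\<close>)
    then show ?thesis by simp
  qed
  note eq = finite_annihilation_eq[OF fin \<alpha>(1)] finite_annihilation_eq[OF fin \<alpha>(2)]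
  show ?thesis
  proof (cases "favoured v")
    case True
    then obtain e where e: "e \<in> induced_edges E U" "v \<in> e" "attack_time \<sigma> \<alpha> (e, v) \<le> ereal t"
      "attack_armed E \<sigma> \<alpha> U (e, v)"
      using state unfolding eq by (auto split: if_splits)
    then have "attack_time \<sigma>' \<alpha>' (e, v) \<le> ereal t" "attack_armed E \<sigma>' \<alpha>' U (e, v)"
      using times[OF e(1,2)] armed[OF e(1,2)] True by (auto intro: order_trans)
    then show ?thesis unfolding eq using True e(1,2) by auto
  next
    case False
    have "\<not> (attack_time \<sigma>' \<alpha>' (e, v) \<le> ereal t \<and> attack_armed E \<sigma>' \<alpha>' U (e, v))"
      if e: "e \<in> induced_edges E U" "v \<in> e" for e
    proof
      assume "attack_time \<sigma>' \<alpha>' (e, v) \<le> ereal t \<and> attack_armed E \<sigma>' \<alpha>' U (e, v)"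
      then have "attack_time \<sigma> \<alpha> (e, v) \<le> ereal t" "attack_armed E \<sigma> \<alpha> U (e, v)"
        using times[OF e] armed[OF e] False by (auto intro: order_trans)
      then show False using state False e unfolding eq by (auto split: if_splits)
    qed
    then show ?thesis unfolding eq using False by auto
  qed
qed

lemma measurable_finite_annihilation:
  assumes "finite U" and \<alpha>: "\<And>e \<omega>. e \<in> induced_edges E U \<Longrightarrow> \<omega> \<in> space M \<Longrightarrow> \<alpha> \<omega> e \<in> e"
    and time: "\<And>e x. e \<in> induced_edges E U \<Longrightarrow> x \<in> e \<Longrightarrow>
      (\<lambda>\<omega>. attack_time (\<sigma> \<omega>) (\<alpha> \<omega>) (e, x)) \<in> borel_measurable M"
  shows "Measurable.pred M (\<lambda>\<omega>. finite_annihilation E (\<sigma> \<omega>) (\<alpha> \<omega>) U t v = y)"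
proof -
  let ?S = "directed_edges (induced_edges E U)"
  have fin: "finite (induced_edges E U)" by (rule finite_induced_edges) fact
  have finS: "finite ?S"
  proof (rule finite_subset)
    show "?S \<subseteq> induced_edges E U \<times> U" by (auto simp: directed_edges_def induced_edges_def)
  qed (use fin assms(1) in auto)
  have armed: "Measurable.pred M (\<lambda>\<omega>. attack_armed E (\<sigma> \<omega>) (\<alpha> \<omega>) U (e, x))"
    if "e \<in> induced_edges E U" "x \<in> e" for e x
  proof (rule measurable_blocking_solution[OF finS])
    show "(\<lambda>\<omega>. attack_time (\<sigma> \<omega>) (\<alpha> \<omega>) i) \<in> borel_measurable M" if "i \<in> ?S" for i
      using time[of "fst i" "snd i"] that by (auto simp: directed_edges_def)
    show "blocking_solution attacks ?S (attack_time (\<sigma> \<omega>) (\<alpha> \<omega>)) (attack_armed E (\<sigma> \<omega>) (\<alpha> \<omega>) U)"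
      if "\<omega> \<in> space M" for \<omega>
      using \<alpha> that by (intro annihilation_blocking_solution fin) auto
  qed (use that in \<open>simp add: directed_edges_def\<close>)
  let ?Q = "\<lambda>\<omega>. \<exists>e\<in>{e\<in>induced_edges E U. v \<in> e}. attack_time (\<sigma> \<omega>) (\<alpha> \<omega>) (e, v) \<le> ereal t \<and>
      attack_armed E (\<sigma> \<omega>) (\<alpha> \<omega>) U (e, v)"
  have [measurable]: "Measurable.pred M ?Q"
  proof (rule pred_intros_finite(4))
    fix e assume e: "e \<in> {e\<in>induced_edges E U. v \<in> e}"
    then have [measurable]: "(\<lambda>\<omega>. attack_time (\<sigma> \<omega>) (\<alpha> \<omega>) (e, v)) \<in> borel_measurable M"
      "Measurable.pred M (\<lambda>\<omega>. attack_armed E (\<sigma> \<omega>) (\<alpha> \<omega>) U (e, v))"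
      using time armed by auto
    show "Measurable.pred M (\<lambda>\<omega>. attack_time (\<sigma> \<omega>) (\<alpha> \<omega>) (e, v) \<le> ereal t \<and>
      attack_armed E (\<sigma> \<omega>) (\<alpha> \<omega>) U (e, v))" by measurable
  qed (use fin in auto)
  have eq: "finite_annihilation E (\<sigma> \<omega>) (\<alpha> \<omega>) U t v = y \<longleftrightarrow> (if ?Q \<omega> then 0 else 1) = y"
    if "\<omega> \<in> space M" for \<omega>
    using finite_annihilation_eq[OF fin, of "\<alpha> \<omega>"] \<alpha> that by auto
  have "Measurable.pred M (\<lambda>\<omega>. (if ?Q \<omega> then 0 else 1) = y)" by measurable
  then show ?thesis by (intro measurable_cong[OF eq, THEN iffD2])
qed

lemma finite_annihilation_converges:
  assumes simple: "simple_graph V E"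
    and wf: "wf {(e', e). e \<in> E \<and> e' \<in> {e'\<in>E. e' \<inter> e \<noteq> {}} \<and> \<sigma> e' < \<sigma> e}"
    and locally_finite: "\<And>x. finite {e\<in>E. x \<in> e}"
    and \<alpha>: "\<forall>e\<in>E. \<alpha> e \<in> e" and "U \<subseteq> V"
  shows "\<exists>x. \<forall>\<^sub>F F in finite_subsets_at_top U. finite_annihilation E \<sigma> \<alpha> F t v = x"
proof -
  let ?D = "\<lambda>U. directed_edges (induced_edges E U)"
  have card: "card e = 2" "finite e" if "e \<in> E" for e
    using simple that by (auto simp: simple_graph_def intro: card_ge_0_finite)
  have \<alpha>': "\<forall>e\<in>induced_edges E F. \<alpha> e \<in> e" for F using \<alpha> by (auto simp: induced_edges_def)
  have edge: "\<forall>\<^sub>F F in finite_subsets_at_top U. e \<in> induced_edges E F" if "e \<in> induced_edges E U" for e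
  proof -
    have "\<forall>\<^sub>F F in finite_subsets_at_top U. e \<subseteq> F"
      using that card by (intro eventually_subset_finite_subsets) (auto simp: induced_edges_def)
    then show ?thesis by eventually_elim (use that in \<open>auto simp: induced_edges_def\<close>)
  qed
  have sub: "\<forall>\<^sub>F F in finite_subsets_at_top U. induced_edges E F \<subseteq> induced_edges E U"
    using eventually_finite_subsets by eventually_elim (auto simp: induced_edges_def)
  have armed: "\<exists>b. \<forall>\<^sub>F F in finite_subsets_at_top U. attack_armed E \<sigma> \<alpha> F i = b"
    if "i \<in> ?D U" for i
  proof (rule blocking_solutions_converge[where R=attacks and S="?D U" and S'="?D" and T="attack_time \<sigma> \<alpha>"])
    show "wf {(i, j). j \<in> ?D U \<and> i \<in> ?D U \<and> attacks i j \<and>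
        attack_time \<sigma> \<alpha> i < attack_time \<sigma> \<alpha> j \<and> attack_time \<sigma> \<alpha> j < \<infinity>}"
      by (rule wf_subset[OF wf_inv_image[OF wf, of fst]])
        (auto simp: attack_time_def attacks_def directed_edges_def induced_edges_def inv_image_def split: if_splits)
    show "finite {j \<in> ?D U. attacks j i}" if "i \<in> ?D U" for i
    proof (rule finite_subset)
      show "{j \<in> ?D U. attacks j i} \<subseteq> (\<lambda>(x, e). (e, x)) ` (SIGMA x:fst i. {e\<in>E. x \<in> e})"
        by (auto simp: attacks_def directed_edges_def induced_edges_def)
      show "finite ((\<lambda>(x, e). (e, x)) ` (SIGMA x:fst i. {e\<in>E. x \<in> e}))"
        using that card locally_finite by (auto simp: directed_edges_def induced_edges_def)
    qed
    show "\<forall>\<^sub>F F in finite_subsets_at_top U.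
        blocking_solution attacks (?D F) (attack_time \<sigma> \<alpha>) (attack_armed E \<sigma> \<alpha> F)"
      using eventually_finite_subsets
      by eventually_elim (intro annihilation_blocking_solution \<alpha>' finite_induced_edges, simp)
    show "\<forall>\<^sub>F F in finite_subsets_at_top U. ?D F \<subseteq> ?D U"
      using sub by eventually_elim (auto simp: directed_edges_def)
    show "\<forall>\<^sub>F F in finite_subsets_at_top U. i \<in> ?D F" if "i \<in> ?D U" for i
    proof -
      have "\<forall>\<^sub>F F in finite_subsets_at_top U. fst i \<in> induced_edges E F"
        using that by (intro edge) (auto simp: directed_edges_def)
      then show ?thesis by eventually_elim (use that in \<open>auto simp: directed_edges_def\<close>)
    qed
  qed (rule that)
  define Ev where "Ev = {e\<in>induced_edges E U. v \<in> e}"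
  have fin: "finite Ev"
    unfolding Ev_def by (rule finite_subset[OF _ locally_finite[of v]]) (auto simp: induced_edges_def)
  have "\<forall>e\<in>Ev. \<exists>b. \<forall>\<^sub>F F in finite_subsets_at_top U. attack_armed E \<sigma> \<alpha> F (e, v) = b"
    by (intro ballI armed) (auto simp: Ev_def directed_edges_def)
  then obtain b where "\<And>e. e \<in> Ev \<Longrightarrow> \<forall>\<^sub>F F in finite_subsets_at_top U. attack_armed E \<sigma> \<alpha> F (e, v) = b e"
    by metis
  then have "\<forall>\<^sub>F F in finite_subsets_at_top U. \<forall>e\<in>Ev. attack_armed E \<sigma> \<alpha> F (e, v) = b e"
    using fin by (simp add: eventually_ball_finite_distrib)
  moreover have "\<forall>\<^sub>F F in finite_subsets_at_top U. \<forall>e\<in>Ev. e \<in> induced_edges E F"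
    using fin edge by (simp add: eventually_ball_finite_distrib) (simp add: Ev_def)
  ultimately have "\<forall>\<^sub>F F in finite_subsets_at_top U. finite_annihilation E \<sigma> \<alpha> F t v =
      (if \<exists>e\<in>Ev. attack_time \<sigma> \<alpha> (e, v) \<le> ereal t \<and> b e then 0 else 1)"
    using sub eventually_finite_subsets
  proof eventually_elim
    case (elim F)
    have fin: "finite (induced_edges E F)" using elim by (intro finite_induced_edges) simp
    have "(\<exists>e\<in>induced_edges E F. v \<in> e \<and> attack_time \<sigma> \<alpha> (e, v) \<le> ereal t \<and> attack_armed E \<sigma> \<alpha> F (e, v))
        \<longleftrightarrow> (\<exists>e\<in>Ev. attack_time \<sigma> \<alpha> (e, v) \<le> ereal t \<and> b e)"
      using elim unfolding Ev_def by blast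
    then show ?case by (simp add: finite_annihilation_eq[OF fin \<alpha>'])
  qed
  then show ?thesis by blast
qed

text \<open>Going up in this order advances the attack on the favoured endpoint of \<open>e\<close> and delays the attack on the
  other one, where the attack that is not drawn has time \<open>\<infinity>\<close>.\<close>

definition annihilation_le ::
    "('a \<Rightarrow> bool) \<Rightarrow> 'a set \<Rightarrow> real \<times> 'a \<Rightarrow> real \<times> 'a \<Rightarrow> bool" where
  "annihilation_le favoured e p q \<longleftrightarrow> (\<forall>x\<in>e.
     if favoured x then attack_time (\<lambda>_. fst q) (\<lambda>_. snd q) (e, x) \<le> attack_time (\<lambda>_. fst p) (\<lambda>_. snd p) (e, x)
     else attack_time (\<lambda>_. fst p) (\<lambda>_. snd p) (e, x) \<le> attack_time (\<lambda>_. fst q) (\<lambda>_. snd q) (e, x))"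

text \<open>Only one of the two attack times of an edge is finite. So any attack on the favoured endpoint lies
  above any attack on the other one, and attacks on the same endpoint are compared by their times.\<close>

lemma annihilation_le_total:
  assumes "card e = 2" and alternate: "\<And>x y. e = {x, y} \<Longrightarrow> favoured x \<longleftrightarrow> \<not> favoured y"
    and "snd p \<in> e" "snd q \<in> e"
  shows "annihilation_le favoured e p q \<or> annihilation_le favoured e q p"
proof -
  obtain a b where ab: "e = {a, b}" "a \<noteq> b" "favoured a" "\<not> favoured b"
    using assms(1) alternate by (metis card_2_iff insert_commute)
  show ?thesis
    using assms(3,4) ab(2-4) unfolding ab(1) annihilation_le_def attack_time_def by auto
qed

lemma distr_fst_pair_prob:
  assumes "prob_space A" "prob_space B"
  shows "distr (A \<Otimes>\<^sub>M B) A fst = A"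
proof -
  interpret A: prob_space A by fact
  interpret B: prob_space B by fact
  interpret pair_prob_space A B ..
  show ?thesis
  proof (rule measure_eqI)
    fix X assume "X \<in> sets (distr (A \<Otimes>\<^sub>M B) A fst)"
    then have X: "X \<in> sets A" by simp
    then have "emeasure (distr (A \<Otimes>\<^sub>M B) A fst) X = emeasure (A \<Otimes>\<^sub>M B) (X \<times> space B)"
      by (subst emeasure_distr)
        (auto simp: space_pair_measure dest: sets.sets_into_space intro!: arg_cong[where f="emeasure _"])
    also have "\<dots> = emeasure A X"
      using X by (simp add: B.emeasure_pair_measure_Times B.emeasure_space_1)
    finally show "emeasure (distr (A \<Otimes>\<^sub>M B) A fst) X = emeasure A X" .
  qed simp
qed

lemma adjacent_edges_bounds:
  assumes "finite e" "\<And>x. finite {e\<in>E. x \<in> e}" "\<And>x. card {e\<in>E. x \<in> e} \<le> d"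
  shows "finite {e'\<in>E. e' \<inter> e \<noteq> {}}" "card {e'\<in>E. e' \<inter> e \<noteq> {}} \<le> card e * d"
proof -
  have eq: "{e'\<in>E. e' \<inter> e \<noteq> {}} = (\<Union>x\<in>e. {e'\<in>E. x \<in> e'})" by auto
  show "finite {e'\<in>E. e' \<inter> e \<noteq> {}}" unfolding eq using assms by auto
  have "card {e'\<in>E. e' \<inter> e \<noteq> {}} \<le> (\<Sum>x\<in>e. card {e'\<in>E. x \<in> e'})"
    unfolding eq by (rule card_UN_le) fact
  also have "\<dots> \<le> (\<Sum>x\<in>e. d)" by (rule sum_mono) (rule assms(3))
  finally show "card {e'\<in>E. e' \<inter> e \<noteq> {}} \<le> card e * d" by simp
qed

theorem annihilation_positive_association:
  fixes \<sigma> :: "'a set \<Rightarrow> 'n \<Rightarrow> real"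
  assumes rnd: "annihilation_randomness M E \<sigma> \<alpha>" and "countable V" and graph: "simple_graph V E" "bounded_degree V E"
    and alternate: "\<And>x y. {x, y} \<in> E \<Longrightarrow> favoured x \<longleftrightarrow> \<not> favoured y"
    and J: "finite J\<^sub>1" "finite J\<^sub>2" "\<And>j. j \<in> J\<^sub>1 \<union> J\<^sub>2 \<Longrightarrow> W j \<subseteq> V"
  defines "s \<equiv> \<lambda>x. if favoured x then 0 else 1"
  shows "\<P>(\<omega> in M. \<forall>j\<in>J\<^sub>1. annihilation E (\<lambda>e. \<sigma> e \<omega>) (\<lambda>e. \<alpha> e \<omega>) (W j) (t j) (v j) = s (v j))
      * \<P>(\<omega> in M. \<forall>j\<in>J\<^sub>2. annihilation E (\<lambda>e. \<sigma> e \<omega>) (\<lambda>e. \<alpha> e \<omega>) (W j) (t j) (v j) = s (v j))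
    \<le> \<P>(\<omega> in M. \<forall>j\<in>J\<^sub>1 \<union> J\<^sub>2. annihilation E (\<lambda>e. \<sigma> e \<omega>) (\<lambda>e. \<alpha> e \<omega>) (W j) (t j) (v j) = s (v j))"
proof -
  let ?N = "\<lambda>e. (borel :: real measure) \<Otimes>\<^sub>M count_space e"
  let ?X = "\<lambda>p. finite_annihilation E (\<lambda>e. fst (p e)) (\<lambda>e. snd (p e))"
  let ?Y = "\<lambda>e \<omega>. (\<sigma> e \<omega>, \<alpha> e \<omega>)"
  have "prob_space M" and indep: "prob_space.indep_vars M ?N ?Y E"
    and law: "\<And>e. e \<in> E \<Longrightarrow> distr M (?N e) (?Y e) = uniform_measure lborel {0<..<1} \<Otimes>\<^sub>M uniform_count_measure e"
    using rnd by (auto simp: annihilation_randomness_def)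
  interpret prob_space M by fact
  have edge: "card e = 2" "finite e" "e \<noteq> {}" if "e \<in> E" for e
    using graph(1) that by (auto simp: simple_graph_def intro: card_ge_0_finite)
  obtain d where d: "\<And>x. finite {e\<in>E. x \<in> e}" "\<And>x. card {e\<in>E. x \<in> e} \<le> d"
    using bounded_degree_edges_at[OF graph] by metis
  have rv: "?Y e \<in> measurable M (?N e)" if "e \<in> E" for e
    using indep that by (auto simp: indep_vars_def)
  have "countable E"
  proof (rule countable_subset)
    show "E \<subseteq> {e. e \<subseteq> V \<and> finite e}" using graph(1) edge by (auto simp: simple_graph_def)
    show "countable {e. e \<subseteq> V \<and> finite e}"
      using countable_Collect_finite_subset[OF \<open>countable V\<close>] by (simp add: conj_commute)
  qed
  have no_descent: "AE \<omega> in M. wf {(e', e). e \<in> E \<and> e' \<in> {e'\<in>E. e' \<inter> e \<noteq> {}} \<and> \<sigma> e' \<omega> < \<sigma> e \<omega>}"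
  proof (rule AE_no_infinite_descent)
    show "indep_vars (\<lambda>_. borel) \<sigma> E"
      using indep_vars_compose2[OF indep, of "\<lambda>_. fst" "\<lambda>_. borel"] by simp
    show "distr M borel (\<sigma> e) = uniform_measure lborel {0<..<1}" if "e \<in> E" for e
    proof -
      let ?U = "uniform_measure lborel {0<..<1::real}"
      have U: "prob_space ?U" by (rule prob_space_uniform_measure) auto
      have C: "prob_space (uniform_count_measure e)"
        using edge[OF that] by (intro prob_space_uniform_count_measure)
      have "distr M borel (\<sigma> e) = distr (distr M (?N e) (?Y e)) borel fst"
        using rv[OF that] by (subst distr_distr) (auto simp: comp_def)
      also have "\<dots> = distr (?U \<Otimes>\<^sub>M uniform_count_measure e) ?U fst"
        unfolding law[OF that] by (rule distr_cong) auto
      also have "\<dots> = ?U" by (rule distr_fst_pair_prob[OF U C])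
      finally show ?thesis .
    qed
    show "card {e'\<in>E. e' \<inter> e \<noteq> {}} \<le> 2 * d" "finite {e'\<in>E. e' \<inter> e \<noteq> {}}" if "e \<in> E" for e
      using adjacent_edges_bounds[OF edge(2)[OF that] d] edge(1)[OF that] by auto
  qed (use \<open>prob_space M\<close> \<open>countable E\<close> in auto)
  have "\<alpha> e \<omega> \<in> e" if "e \<in> E" "\<omega> \<in> space M" for e \<omega>
    using measurable_space[OF rv[OF that(1)] that(2)] by (simp add: space_pair_measure)
  then have \<alpha>: "AE \<omega> in M. \<forall>e\<in>E. \<alpha> e \<omega> \<in> e" by (intro AE_I2 ballI)
  have coord: "snd (p e) \<in> e" if "p \<in> space (PiM (induced_edges E F) ?N)" "e \<in> induced_edges E F" for p e F
    using that by (auto simp: space_PiM space_pair_measure dest!: PiE_mem)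
  show ?thesis
    unfolding annihilation_def
  proof (rule positive_association_limit[where X="?X" and Y="?Y" and I=E and C="induced_edges E"
        and N="?N" and le="annihilation_le favoured" and V=V, simplified fst_conv snd_conv])
    show "annihilation_le favoured e p q \<or> annihilation_le favoured e q p"
      if "e \<in> E" "p \<in> space (?N e)" "q \<in> space (?N e)" for e p q
      using that alternate edge(1)
      by (intro annihilation_le_total) (auto simp: space_pair_measure)
    show "finite (induced_edges E U) \<and> induced_edges E U \<subseteq> E" if "finite U" for U
      using finite_induced_edges[OF that] by (auto simp: induced_edges_def)
    show "induced_edges E U \<subseteq> induced_edges E F" if "U \<subseteq> F" for U F
      using that by (auto simp: induced_edges_def)
    show "?X p U = ?X q U" if "\<forall>e\<in>induced_edges E U. p e = q e" for p q U
      using that by (intro finite_annihilation_cong) auto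
    show "AE \<omega> in M. \<forall>U\<subseteq>V. \<forall>t v. \<exists>x. \<forall>\<^sub>F F in finite_subsets_at_top U.
        finite_annihilation E (\<lambda>e. \<sigma> e \<omega>) (\<lambda>e. \<alpha> e \<omega>) F t v = x"
      using no_descent \<alpha>
      by eventually_elim (intro allI impI finite_annihilation_converges[OF graph(1)] d(1))
  next
    fix U F t v p q
    assume F: "finite F" "F \<subseteq> V" "U \<subseteq> F"
      and p: "p \<in> space (PiM (induced_edges E F) ?N)" and q: "q \<in> space (PiM (induced_edges E F) ?N)"
      and le: "\<forall>e\<in>induced_edges E F. annihilation_le favoured e (p e) (q e)"
      and state: "?X p U t v = s v"
    have sub: "induced_edges E U \<subseteq> induced_edges E F" using F by (auto simp: induced_edges_def)
    show "?X q U t v = s v"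
      unfolding s_def
    proof (rule finite_annihilation_mono[where \<sigma>="\<lambda>e. fst (p e)" and \<alpha>="\<lambda>e. snd (p e)"])
      show "finite U" using F finite_subset by blast
      show "if favoured x then attack_time (\<lambda>e. fst (q e)) (\<lambda>e. snd (q e)) (e, x) \<le> attack_time (\<lambda>e. fst (p e)) (\<lambda>e. snd (p e)) (e, x)
        else attack_time (\<lambda>e. fst (p e)) (\<lambda>e. snd (p e)) (e, x) \<le> attack_time (\<lambda>e. fst (q e)) (\<lambda>e. snd (q e)) (e, x)"
        if "e \<in> induced_edges E U" "x \<in> e" for e x
      proof -
        have "annihilation_le favoured e (p e) (q e)" using le sub that(1) by blast
        from bspec[OF this[unfolded annihilation_le_def] that(2)] show ?thesis
          by (simp only: attack_time_def prod.case)
      qed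
    qed (use edge alternate coord[OF p] coord[OF q] sub state in \<open>auto simp: s_def\<close>)
  next
    fix U F t v and x :: nat
    assume F: "finite F" "F \<subseteq> V" "U \<subseteq> F"
    have sub: "induced_edges E U \<subseteq> induced_edges E F" using F by (auto simp: induced_edges_def)
    show "Measurable.pred (PiM (induced_edges E F) ?N) (\<lambda>p. ?X p U t v = x)"
    proof (rule measurable_finite_annihilation)
      show "finite U" using F finite_subset by blast
      show "snd (p e) \<in> e" if "e \<in> induced_edges E U" "p \<in> space (PiM (induced_edges E F) ?N)" for e p
        using coord that sub by blast
      fix e y assume e: "e \<in> induced_edges E U" "y \<in> e"
      have comp [measurable]: "(\<lambda>p. p e) \<in> measurable (PiM (induced_edges E F) ?N) (?N e)"
        using e sub by (intro measurable_component_singleton) auto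
      have "Measurable.pred (PiM (induced_edges E F) ?N) (\<lambda>p. snd (p e) = y)"
        by (rule measurable_compose[OF measurable_compose[OF comp measurable_snd]]) simp
      then show "(\<lambda>p. attack_time (\<lambda>e. fst (p e)) (\<lambda>e. snd (p e)) (e, y)) \<in> borel_measurable (PiM (induced_edges E F) ?N)"
        unfolding attack_time_def by simp measurable
    qed
  qed (use \<open>prob_space M\<close> indep \<open>countable V\<close> J in auto)
qed

section \<open>Correlation of the parity events\<close>

theorem theorem5:
  fixes V :: "'a set" and E :: "'a set set"
    and k :: nat and W :: "nat \<Rightarrow> 'a set" and v :: "nat \<Rightarrow> 'a" and t :: "nat \<Rightarrow> real"
    and M :: "'m measure" and \<tau> :: "'a \<Rightarrow> 'm \<Rightarrow> real"
    and N :: "'n measure" and \<sigma> :: "'a set \<Rightarrow> 'n \<Rightarrow> real" and \<alpha> :: "'a set \<Rightarrow> 'n \<Rightarrow> 'a"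
  assumes "simple_graph V E"
    and "bipartite V E"
    and "finite V \<or> (infinite V \<and> countable V \<and> bounded_degree V E)"
    and "\<forall>j\<in>{0..k}. W j \<subseteq> V \<and> v j \<in> W j \<and> t j \<in> {0..1} \<and> finite_dist E (v j) (v 0)"
  shows
    "(rsa_randomness M V \<tau> \<longrightarrow>
       \<P>(\<omega> in M. \<forall>j\<in>{0..k}.
           blocking_rsa E (\<lambda>x. \<tau> x \<omega>) (W j) (t j) (v j) = parity_state E (v 0) (v j))
       \<ge> \<P>(\<omega> in M.
           blocking_rsa E (\<lambda>x. \<tau> x \<omega>) (W 0) (t 0) (v 0) = parity_state E (v 0) (v 0))
         * \<P>(\<omega> in M. \<forall>j\<in>{1..k}.
           blocking_rsa E (\<lambda>x. \<tau> x \<omega>) (W j) (t j) (v j) = parity_state E (v 0) (v j)))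
     \<and>
     (annihilation_randomness N E \<sigma> \<alpha> \<longrightarrow>
       \<P>(\<omega> in N. \<forall>j\<in>{0..k}.
           annihilation E (\<lambda>e. \<sigma> e \<omega>) (\<lambda>e. \<alpha> e \<omega>) (W j) (t j) (v j) = parity_state E (v 0) (v j))
       \<ge> \<P>(\<omega> in N.
           annihilation E (\<lambda>e. \<sigma> e \<omega>) (\<lambda>e. \<alpha> e \<omega>) (W 0) (t 0) (v 0) = parity_state E (v 0) (v 0))
         * \<P>(\<omega> in N. \<forall>j\<in>{1..k}.
           annihilation E (\<lambda>e. \<sigma> e \<omega>) (\<lambda>e. \<alpha> e \<omega>) (W j) (t j) (v j) = parity_state E (v 0) (v j)))"
proof -
  obtain A where A: "\<And>x y. {x, y} \<in> E \<Longrightarrow> x \<in> A \<longleftrightarrow> y \<notin> A"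
    using bipartite_colouring[OF assms(1,2)] by metis
  \<comment> \<open>The sites at even distance from \<open>v 0\<close>, expressed by the bipartition: each event asks for state \<open>0\<close> there and for \<open>1\<close> elsewhere.\<close>
  define even_site where "even_site x \<longleftrightarrow> (x \<in> A \<longleftrightarrow> v 0 \<in> A)" for x
  have alternate: "even_site x \<longleftrightarrow> \<not> even_site y" if "{x, y} \<in> E" for x y
    using A[OF that] by (auto simp: even_site_def)
  have parity: "parity_state E (v 0) (v j) = (if even_site (v j) then 0 else 1)" if "j \<in> {0..k}" for j
    using parity_state_eq[OF A, where v="v j" and v\<^sub>0="v 0"] assms(4) that by (auto simp: even_site_def)
  have countable: "countable V" and degree: "bounded_degree V E"
    using assms(3) bounded_degree_if_finite[OF _ assms(1)] by (auto intro: countable_finite)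
  have split: "{0..k} = {0} \<union> {1..k}" by auto
  have W: "W j \<subseteq> V" if "j \<in> {0} \<union> {1..k}" for j using assms(4) that by auto
  have rsa: "\<P>(\<omega> in M. \<forall>j\<in>{0}. blocking_rsa E (\<lambda>x. \<tau> x \<omega>) (W j) (t j) (v j) = (if \<not> even_site (v j) then 1 else 0))
      * \<P>(\<omega> in M. \<forall>j\<in>{1..k}. blocking_rsa E (\<lambda>x. \<tau> x \<omega>) (W j) (t j) (v j) = (if \<not> even_site (v j) then 1 else 0))
    \<le> \<P>(\<omega> in M. \<forall>j\<in>{0} \<union> {1..k}. blocking_rsa E (\<lambda>x. \<tau> x \<omega>) (W j) (t j) (v j) = (if \<not> even_site (v j) then 1 else 0))"
    if "rsa_randomness M V \<tau>"
    using alternate by (intro rsa_positive_association[OF that countable assms(1) degree] W) auto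
  have annihilation: "\<P>(\<omega> in N. \<forall>j\<in>{0}. annihilation E (\<lambda>e. \<sigma> e \<omega>) (\<lambda>e. \<alpha> e \<omega>) (W j) (t j) (v j) = (if even_site (v j) then 0 else 1))
      * \<P>(\<omega> in N. \<forall>j\<in>{1..k}. annihilation E (\<lambda>e. \<sigma> e \<omega>) (\<lambda>e. \<alpha> e \<omega>) (W j) (t j) (v j) = (if even_site (v j) then 0 else 1))
    \<le> \<P>(\<omega> in N. \<forall>j\<in>{0} \<union> {1..k}. annihilation E (\<lambda>e. \<sigma> e \<omega>) (\<lambda>e. \<alpha> e \<omega>) (W j) (t j) (v j) = (if even_site (v j) then 0 else 1))"
    if "annihilation_randomness N E \<sigma> \<alpha>"
    by (intro annihilation_positive_association[OF that countable assms(1) degree] W alternate) auto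
  have state: "(\<forall>j\<in>J. x j = (if \<not> even_site (v j) then 1 else 0)) \<longleftrightarrow> (\<forall>j\<in>J. x j = parity_state E (v 0) (v j))"
    "(\<forall>j\<in>J. x j = (if even_site (v j) then 0 else 1)) \<longleftrightarrow> (\<forall>j\<in>J. x j = parity_state E (v 0) (v j))"
    if "J \<subseteq> {0..k}" for J and x :: "nat \<Rightarrow> nat"
    using parity that by (auto intro!: ball_cong)
  have J: "{0} \<subseteq> {0..k}" "{1..k} \<subseteq> {0..k}" by auto
  show ?thesis
    using rsa annihilation
    unfolding split[symmetric] state[OF J(1)] state[OF J(2)] state[OF subset_refl] by simp
qed

end
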